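(* Let $0<q<1$ and $a,b\in\mathbb{C}$. For $z$ on the Riemann surface of the logarithm let $$w(z)=C_q\int_0^\infty B_q(t)\,\mathrm{E}_q(t/z)\,\frac{dt}{t}$$ be the $q$-Borel-Laplace transform of the formal series ${}_2\phi_0(a,b;-;q,z)$. Then, as $z\to0$ (with $\arg z$ fixed), $$w\left(e^{-2\pi i}z\right)-w(z)\sim 2\pi i\,C_q\,\mathrm{E}_q(-1/z)\sum_{n=0}^\infty d_n(a,b)\,q^{\frac12n(n+1)}(-z)^n,$$ where $-1/z$ is to be read as $e^{\pi i}/z$ in $\mathrm{E}_q$. Here $\sim$ means that, after division by $2\pi i\,C_q\,\mathrm{E}_q(e^{\pi i}/z)$, the left-hand side has the displayed power series as its Poincaré asymptotic expansion.
   Context: Notation: $(x;q)_\infty=\prod_{n=0}^\infty(1-xq^n)$, $(x;q)_n=(1-x)(1-xq)\cdots(1-xq^{n-1})$, $(x;q)_0=1$. The formal series is ${}_2\phi_0(a,b;-;q,z)=\sum_{n=0}^\infty\frac{(a;q)_n(b;q)_n}{(q;q)_n}q^{-\frac12 n(n-1)}(-z)^n$. Its $q$-Borel transform is $B_q(t)=\sum_{n=0}^\infty\frac{(a;q)_n(b;q)_n}{(q;q)_n}(-t)^n$ for $|t|<1$, continued analytically to a meromorphic function of $t\in\mathbb{C}$ whose singularities are at most simple poles at $t=-q^{-j}$, $j=0,1,2,\ldots$. For $\tau$ on the Riemann surface of the logarithm, $\mathrm{E}_q(\tau)=\exp\left(\frac{(\ln(\tau/\sqrt q))^2}{2\ln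 q}\right)=q^{1/8}\tau^{-1/2}\exp\left(\frac{\ln^2\tau}{2\ln q}\right)$, and $C_q=\frac{1}{\sqrt{-2\pi\ln q}}$. In the integral defining $w$, $t$ runs over $(0,\infty)$ with $\arg t=0$, so $\ln(t/z)=\ln t-\ln z$. The numbers $d_j(a,b)$ are defined by $d_{-1}(a,b)=0$, $d_0(a,b)=\frac{(a;q)_\infty(b;q)_\infty}{(q;q)_\infty}$ and $(1-q^{-j})d_j(a,b)=(1-(a+b)q^{-j})d_{j-1}(a,b)+abq^{-j}d_{j-2}(a,b)$ for $j\ge1$. *)

theory Defs
  imports "HOL-Complex_Analysis.Complex_Analysis" "HOL-Library.Landau_Symbols"
begin

definition qpoch :: "complex \<Rightarrow> real \<Rightarrow> nat \<Rightarrow> complex" where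
  "qpoch x q n = (\<Prod>k<n. 1 - x * of_real q ^ k)"

definition qpoch_inf :: "complex \<Rightarrow> real \<Rightarrow> complex" where
  "qpoch_inf x q = (\<Prod>n. 1 - x * of_real q ^ n)"

text \<open>
  The q-Borel transform multiplies the coefficient of \<open>z ^ n\<close> in the formal series
  2phi0(a, b; -; q, z), namely
  \<open>(a;q)\<^sub>n (b;q)\<^sub>n / (q;q)\<^sub>n * q powr (- n (n - 1) / 2) * (- 1) ^ n\<close>, by
  \<open>q powr (n (n - 1) / 2)\<close>.
\<close>

definition qBorel_series :: "real \<Rightarrow> complex \<Rightarrow> complex \<Rightarrow> complex \<Rightarrow> complex" where
  "qBorel_series q a b t =
     (\<Sum>n. qpoch a q n * qpoch b q n / qpoch (of_real q) q n * (- t) ^ n)"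

text \<open>
  The meromorphic continuation to the whole plane. Requiring \<open>nicely_meromorphic_on\<close>
  (removable singularities removed, value 0 at poles) makes the continuation unique as a
  total function; the values at the poles play no role below.
\<close>

definition qBorel :: "real \<Rightarrow> complex \<Rightarrow> complex \<Rightarrow> complex \<Rightarrow> complex" where
  "qBorel q a b = (THE f. f nicely_meromorphic_on UNIV \<and>
                          (\<forall>t. norm t < 1 \<longrightarrow> f t = qBorel_series q a b t))"

text \<open>
  A point \<open>z\<close> of the Riemann surface of the logarithm is represented by its logarithm
  \<open>ln z = ln \<bar>z\<bar> + \<i> arg z\<close>, which identifies that surface with the complex plane.
  Thus \<open>exp\<close> is the projection to the punctured plane, multiplication and division on the
  surface become addition and subtraction, and \<open>e\<^sup>\<i>\<^sup>\<alpha>\<close> acts by adding \<open>\<i> \<alpha>\<close>.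
\<close>

type_synonym log_surface = complex

definition surface_pt :: "real \<Rightarrow> real \<Rightarrow> log_surface" where
  "surface_pt r \<theta> = Complex (ln r) \<theta>"

definition Eq :: "real \<Rightarrow> log_surface \<Rightarrow> complex" where
  "Eq q \<tau> = exp ((\<tau> - of_real (ln (sqrt q))) ^ 2 / (2 * of_real (ln q)))"

definition Cq :: "real \<Rightarrow> real" where
  "Cq q = 1 / sqrt (- 2 * pi * ln q)"

definition qBL :: "real \<Rightarrow> complex \<Rightarrow> complex \<Rightarrow> log_surface \<Rightarrow> complex" where
  "qBL q a b z = of_real (Cq q) *
     (LBINT t:{0<..}. qBorel q a b (of_real t) * Eq q (surface_pt t 0 - z) / of_real t)"

fun d_coeff :: "real \<Rightarrow> complex \<Rightarrow> complex \<Rightarrow> nat \<Rightarrow> complex" where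
  "d_coeff q a b 0 = qpoch_inf a q * qpoch_inf b q / qpoch_inf (of_real q) q"
| "d_coeff q a b (Suc 0) =
     (1 - (a + b) / of_real q) * d_coeff q a b 0 / (1 - 1 / of_real q)"
| "d_coeff q a b (Suc (Suc j)) =
     ((1 - (a + b) / of_real q ^ (j + 2)) * d_coeff q a b (Suc j)
        + a * b / of_real q ^ (j + 2) * d_coeff q a b j) / (1 - 1 / of_real q ^ (j + 2))"

text \<open>
  Poincare expansion \<open>f(z) \<sim> \<Sum>n. c n * z\<^sup>n\<close> as \<open>z \<rightarrow> 0\<close> on the surface along the ray
  \<open>arg z = \<theta>\<close>.
\<close>

definition poincare_expansion ::
    "(log_surface \<Rightarrow> complex) \<Rightarrow> (nat \<Rightarrow> complex) \<Rightarrow> real \<Rightarrow> bool" where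
  "poincare_expansion f c \<theta> \<longleftrightarrow>
     (\<forall>N. (\<lambda>r. f (surface_pt r \<theta>) - (\<Sum>n\<le>N. c n * exp (surface_pt r \<theta>) ^ n))
            \<in> o[at_right 0](\<lambda>r. exp (surface_pt r \<theta>) ^ N))"

end

theory Submission
  imports Defs "HOL-Probability.Sinc_Integral"
begin

text \<open>
  The difference of the two lateral values is an exact convergent series, of which the Poincare
  expansion is the Taylor expansion. With \<open>s = ln t\<close>, the two integrals
  \<open>w (e\<^sup>-\<^sup>2\<^sup>\<pi>\<^sup>\<i> z)\<close> and \<open>w z\<close> become integrals of one and the same function
  \<open>B (e\<^sup>s) E\<^sub>q (e\<^sup>s / z)\<close> over the lines \<open>Im s = 2 \<pi>\<close> and \<open>Im s = 0\<close>, because \<open>B (e\<^sup>s)\<close>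
  has period \<open>2 \<pi> \<i>\<close> while \<open>E\<^sub>q\<close> does not. Their difference is therefore a sum of residues
  over the poles between the lines, located at \<open>s = - j ln q + \<pi> \<i>\<close>. The Gaussian \<open>E\<^sub>q\<close>, evaluated
  at these equally spaced points, is \<open>E\<^sub>q (e\<^sup>\<pi>\<^sup>\<i> / z)\<close> times \<open>q ^ (j (j + 1) / 2) (- z) ^ j\<close>, and
  the coefficient \<open>d\<^sub>j\<close> in front of it is \<open>q ^ j\<close> times the residue of \<open>B\<close> at \<open>- q ^ - j\<close>
  (\<open>residue_log_integrand\<close>, \<open>Eq_log_pole\<close>).

  Everything that is needed about \<open>B\<close> follows from the functional equation
  \<open>(1 + t) B t = (1 + (a + b) t) B (q t) - a b t B (q\<^sup>2 t)\<close>, the form that the recurrence of the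
  coefficients of the series takes. It continues \<open>B\<close> from the unit disc to the plane; multiplied
  by \<open>t + q ^ - j\<close> it becomes, in the limit, the recurrence that defines \<open>d\<^sub>j\<close>, with \<open>d\<^sub>0\<close>
  obtained by telescoping (\<open>pole_limit\<close>); and it bounds \<open>B\<close> by a power of \<open>t\<close> as long as
  \<open>t\<close> keeps its relative distance from the poles (\<open>B_growth\<close>). Since \<open>E\<^sub>q\<close> decays faster than any
  power, the integrals converge and the vertical sides of the rectangles
  \<open>\<bar>Re s\<bar> \<le> (n + 1 / 2) \<bar>ln q\<bar>\<close> contribute nothing in the limit (\<open>rectangle\<close>, \<open>stokes_sums\<close>).
\<close>

section \<open>The q-Pochhammer symbol\<close>

lemma convergent_prod_qpoch:
  assumes "0 < q" "q < 1"
  shows "convergent_prod (\<lambda>n. 1 - x * of_real q ^ n :: complex)"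
proof -
  have "summable (\<lambda>n. norm x * q ^ n)"
    using assms by (intro summable_mult summable_geometric) auto
  also have "(\<lambda>n. norm x * q ^ n) = (\<lambda>n. norm ((1 - x * of_real q ^ n) - 1))"
    using assms by (simp add: norm_mult norm_power)
  finally show ?thesis
    by (intro abs_convergent_prod_imp_convergent_prod summable_imp_abs_convergent_prod)
qed

lemma qpoch_tendsto:
  assumes "0 < q" "q < 1"
  shows "qpoch x q \<longlonglongrightarrow> qpoch_inf x q"
proof -
  have "(\<lambda>n. qpoch x q (Suc n)) \<longlonglongrightarrow> qpoch_inf x q"
    using convergent_prod_LIMSEQ[OF convergent_prod_qpoch[OF assms, of x]]
    by (simp add: qpoch_def qpoch_inf_def lessThan_Suc_atMost)
  thus ?thesis by (rule LIMSEQ_imp_Suc)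
qed

lemma qpoch_Suc: "qpoch x q (Suc n) = qpoch x q n * (1 - x * of_real q ^ n)"
  by (simp add: qpoch_def)

section \<open>Meromorphic continuation of the q-Borel transform\<close>

lemma analytic_at_scaled:
  fixes c :: complex
  assumes "g analytic_on {c * t}"
  shows "(\<lambda>t. g (c * t)) analytic_on {t}"
proof -
  have "(\<lambda>t. c * t) analytic_on {t}"
    by (intro analytic_on_mult analytic_on_const analytic_on_ident)
  from analytic_on_compose[OF this, of g] show ?thesis
    using assms by (simp add: o_def)
qed

text \<open>
  The functional equation, read as a recursion: a point outside the unit disc is reached from the
  two points \<open>q t\<close> and \<open>q\<^sup>2 t\<close> closer to the origin. At the poles the values are meaningless, and a
  pole whose residue vanishes is left as a removable singularity.
\<close>
function qBorel_cont :: "real \<Rightarrow> complex \<Rightarrow> complex \<Rightarrow> complex \<Rightarrow> complex" where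
  "qBorel_cont q a b t =
     (if 0 < q \<and> q < 1 \<and> 1 \<le> norm t
      then ((1 + (a + b) * t) * qBorel_cont q a b (of_real q * t)
              - a * b * t * qBorel_cont q a b (of_real q ^ 2 * t)) / (1 + t)
      else qBorel_series q a b t)"
  by pat_completeness auto
termination
  \<comment> \<open>The number of multiplications by \<open>q\<close> after which the unit disc is reached.\<close>
proof (relation "Wellfounded.measure (\<lambda>(q, a, b, t). nat \<lfloor>ln (norm t) / (- ln q) + 1\<rfloor>)"; (elim conjE)?)
  fix q :: real and a b t :: complex
  assume q: "0 < q" "q < 1" and t: "1 \<le> norm t"
  have L: "- ln q > 0" using q by simp
  have t0: "t \<noteq> 0" using t by auto
  have x: "ln (norm t) / (- ln q) \<ge> 0" using t L by (intro divide_nonneg_nonneg) auto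
  have "ln (norm (of_real q * t)) = ln (norm t) + ln q"
    using q t0 by (simp add: norm_mult ln_mult)
  hence 1: "ln (norm (of_real q * t)) / (- ln q) = ln (norm t) / (- ln q) - 1"
    using L by (simp add: field_simps)
  have "ln (norm (of_real q ^ 2 * t)) = ln (norm t) + 2 * ln q"
    using q t0 by (simp add: norm_mult norm_power ln_mult ln_realpow)
  hence 2: "ln (norm (of_real q ^ 2 * t)) / (- ln q) = ln (norm t) / (- ln q) - 2"
    using L by (simp add: field_simps)
  show "((q, a, b, of_real q * t), q, a, b, t) \<in> Wellfounded.measure (\<lambda>(q, a, b, t). nat \<lfloor>ln (norm t) / (- ln q) + 1\<rfloor>)"
    unfolding in_measure prod.case 1 using x by linarith
  show "((q, a, b, of_real q ^ 2 * t), q, a, b, t) \<in> Wellfounded.measure (\<lambda>(q, a, b, t). nat \<lfloor>ln (norm t) / (- ln q) + 1\<rfloor>)"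
    unfolding in_measure prod.case 2 using x by linarith
qed auto

declare qBorel_cont.simps [simp del]

locale q_params =
  fixes q :: real and a b :: complex
  assumes q: "0 < q" "q < 1"
begin

definition coef :: "nat \<Rightarrow> complex" where
  "coef n = qpoch a q n * qpoch b q n / qpoch (of_real q) q n"

abbreviation B :: "complex \<Rightarrow> complex" where
  "B \<equiv> qBorel_cont q a b"

abbreviation pole :: "nat \<Rightarrow> complex" where
  "pole j \<equiv> - 1 / of_real q ^ j"

abbreviation d :: "nat \<Rightarrow> complex" where
  "d \<equiv> d_coeff q a b"

lemma q_power_Suc_neq_1: "of_real q * of_real q ^ n \<noteq> (1 :: complex)"
proof -
  have "q * q ^ n < 1" using q power_Suc_less_one[of q n] by simp
  hence "complex_of_real (q * q ^ n) \<noteq> of_real 1"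
    by (subst of_real_eq_iff) auto
  thus ?thesis by simp
qed

lemma qpoch_q_nonzero: "qpoch (of_real q) q n \<noteq> 0"
  using q_power_Suc_neq_1 by (auto simp: qpoch_def)

lemma coef_tendsto: "coef \<longlonglongrightarrow> d 0"
proof -
  have "qpoch_inf (of_real q) q \<noteq> 0"
    unfolding qpoch_inf_def using convergent_prod_qpoch[OF q, of "of_real q"] q_power_Suc_neq_1
    by (intro prodinf_nonzero) auto
  thus ?thesis
    unfolding coef_def d_coeff.simps by (intro tendsto_intros qpoch_tendsto q)
qed

lemma coef_0: "coef 0 = 1"
  by (simp add: coef_def qpoch_def)

text \<open>The recurrence that becomes the functional equation after multiplication by \<open>(- t) ^ n\<close>.\<close>
lemma coef_Suc:
  "coef (Suc n) * (1 - of_real q ^ Suc n) = (1 - (a + b) * of_real q ^ n + a * b * (of_real q ^ 2) ^ n) * coef n"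
proof -
  have "1 - of_real q * of_real q ^ n \<noteq> (0::complex)"
    using q_power_Suc_neq_1[of n] by auto
  moreover have "(1 - a * of_real q ^ n) * (1 - b * of_real q ^ n)
      = 1 - (a + b) * of_real q ^ n + a * b * (of_real q ^ 2 :: complex) ^ n"
    by (simp add: power2_eq_square power_mult_distrib algebra_simps)
  ultimately show ?thesis
    using qpoch_q_nonzero[of n] by (simp add: coef_def qpoch_Suc divide_simps)
qed

lemma series_sums:
  assumes "norm t < 1"
  shows "(\<lambda>n. coef n * (- t) ^ n) sums qBorel_series q a b t"
proof -
  obtain K where K: "\<And>n. norm (coef n) \<le> K"
    using coef_tendsto convergentI convergent_imp_Bseq by (metis Bseq_def)
  have "summable (\<lambda>n. coef n * (- t) ^ n)"
  proof (rule summable_comparison_test)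
    show "summable (\<lambda>n. K * norm t ^ n)"
      using assms by (intro summable_mult summable_geometric) auto
    show "\<exists>N. \<forall>n\<ge>N. norm (coef n * (- t) ^ n) \<le> K * norm t ^ n"
      using K by (auto simp: norm_mult norm_power intro!: mult_right_mono)
  qed
  thus ?thesis
    unfolding qBorel_series_def coef_def by (rule summable_sums)
qed

lemma
  fixes t :: complex
  shows norm_q_mult_less: "norm t < 1 \<Longrightarrow> norm (of_real q * t) < 1" 
  and norm_q2_mult_less: "norm t < 1 \<Longrightarrow> norm (of_real q ^ 2 * t) < 1"
proof -
  assume t: "norm t < 1"
  have "q * norm t \<le> 1 * norm t" "q\<^sup>2 * norm t \<le> 1 * norm t"
    using q by (intro mult_right_mono; simp add: power_le_one)+
  with t q show "norm (of_real q * t) < 1" "norm (of_real q ^ 2 * t) < 1"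
    by (auto simp: norm_mult norm_power)
qed

lemma series_functional_equation:
  assumes "norm t < 1"
  defines "S \<equiv> qBorel_series q a b"
  shows "(1 + t) * S t = (1 + (a + b) * t) * S (of_real q * t) - a * b * t * S (of_real q ^ 2 * t)"
proof -
  have S0: "(\<lambda>n. coef n * (- t) ^ n) sums S t"
    unfolding S_def by (rule series_sums) fact
  have S1: "(\<lambda>n. coef n * (- (of_real q * t)) ^ n) sums S (of_real q * t)"
    unfolding S_def by (intro series_sums norm_q_mult_less assms)
  have S2: "(\<lambda>n. coef n * (- (of_real q ^ 2 * t)) ^ n) sums S (of_real q ^ 2 * t)"
    unfolding S_def by (intro series_sums norm_q2_mult_less assms)
  have pw: "(- (of_real q * t)) ^ n = of_real q ^ n * (- t) ^ n"
           "(- (of_real q ^ 2 * t)) ^ n = (of_real q ^ 2) ^ n * (- t) ^ n" for n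
    by (metis mult_minus_right power_mult_distrib)+
  have "(\<lambda>n. coef n * (- t) ^ n - coef n * (- (of_real q * t)) ^ n) sums (S t - S (of_real q * t))"
    by (intro sums_diff S0 S1)
  hence "(\<lambda>n. coef (Suc n) * (- t) ^ Suc n - coef (Suc n) * (- (of_real q * t)) ^ Suc n)
           sums (S t - S (of_real q * t))"
    using sums_Suc_iff[of "\<lambda>n. coef n * (- t) ^ n - coef n * (- (of_real q * t)) ^ n" "S t - S (of_real q * t)"]
    by simp
  moreover have "(\<lambda>n. - t * (coef n * (- t) ^ n - (a + b) * (coef n * (- (of_real q * t)) ^ n)
                   + a * b * (coef n * (- (of_real q ^ 2 * t)) ^ n)))
           sums (- t * (S t - (a + b) * S (of_real q * t) + a * b * S (of_real q ^ 2 * t)))"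
    by (intro sums_mult sums_add sums_diff S0 S1 S2)
  moreover have "coef (Suc n) * (- t) ^ Suc n - coef (Suc n) * (- (of_real q * t)) ^ Suc n
      = - t * (coef n * (- t) ^ n - (a + b) * (coef n * (- (of_real q * t)) ^ n)
                   + a * b * (coef n * (- (of_real q ^ 2 * t)) ^ n))" for n
  proof -
    have "coef (Suc n) * (- t) ^ Suc n - coef (Suc n) * (- (of_real q * t)) ^ Suc n
            = - t * (coef (Suc n) * (1 - of_real q ^ Suc n)) * (- t) ^ n"
      unfolding pw by (simp add: algebra_simps)
    also have "\<dots> = - t * (coef n * (- t) ^ n - (a + b) * (coef n * (- (of_real q * t)) ^ n)
                   + a * b * (coef n * (- (of_real q ^ 2 * t)) ^ n))"
      unfolding pw coef_Suc by (simp add: algebra_simps)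
    finally show ?thesis .
  qed
  ultimately have "S t - S (of_real q * t)
      = - t * (S t - (a + b) * S (of_real q * t) + a * b * S (of_real q ^ 2 * t))"
    using sums_unique2 by simp
  thus ?thesis by (simp add: algebra_simps)
qed

text \<open>
  The residue at \<open>- 1\<close> is the limit of the coefficients (as in Abel's theorem). Summing
  \<open>coef (Suc n) - coef n\<close>, which by the recurrence is a combination of \<open>q ^ Suc n\<close> times
  \<open>coef (Suc n)\<close> and of \<open>q ^ n\<close> and \<open>q ^ (2 n)\<close> times \<open>coef n\<close>, evaluates this limit by the series
  at \<open>- q\<close> and \<open>- q\<^sup>2\<close>, which are interior points of the disc.
\<close>
lemma d_0_eq:
  "d 0 = (1 - (a + b)) * qBorel_series q a b (- of_real q) + a * b * qBorel_series q a b (- (of_real q ^ 2))"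
proof -
  let ?S = "qBorel_series q a b"
  have "norm (complex_of_real q) < 1" "norm (complex_of_real q ^ 2) < 1"
    using q by (auto simp: norm_power power_less_one_iff)
  hence S1: "(\<lambda>n. coef n * of_real q ^ n) sums ?S (- of_real q)"
    and S2: "(\<lambda>n. coef n * (of_real q ^ 2) ^ n) sums ?S (- (of_real q ^ 2))"
    using series_sums[of "- of_real q"] series_sums[of "- (of_real q ^ 2)"]
    by (simp_all)
  have S1': "(\<lambda>n. coef (Suc n) * of_real q ^ Suc n) sums (?S (- of_real q) - 1)"
    using S1 by (subst sums_Suc_iff) (simp add: coef_0)
  have "(\<lambda>n. coef (Suc n) * of_real q ^ Suc n
           - (a + b) * (coef n * of_real q ^ n) + a * b * (coef n * (of_real q ^ 2) ^ n))
        sums ((?S (- of_real q) - 1) - (a + b) * ?S (- of_real q) + a * b * ?S (- (of_real q ^ 2)))"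
    by (intro sums_mult sums_add sums_diff S1 S1' S2)
  moreover have "coef (Suc n) * of_real q ^ Suc n
           - (a + b) * (coef n * of_real q ^ n) + a * b * (coef n * (of_real q ^ 2) ^ n)
      = coef (Suc n) - coef n" for n
    using coef_Suc[of n] by (simp add: algebra_simps)
  moreover have "(\<lambda>n. coef (Suc n) - coef n) sums (d 0 - 1)"
    using telescope_sums[OF coef_tendsto] by (simp add: coef_0)
  ultimately have "d 0 - 1 = (?S (- of_real q) - 1) - (a + b) * ?S (- of_real q) + a * b * ?S (- (of_real q ^ 2))"
    by (simp only: sums_unique2)
  thus ?thesis by (simp add: algebra_simps del: d_coeff.simps)
qed

lemma B_eq_series: "norm t < 1 \<Longrightarrow> B t = qBorel_series q a b t"
  by (subst qBorel_cont.simps) auto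

lemma B_functional_equation:
  "t \<noteq> -1 \<Longrightarrow> B t = ((1 + (a + b) * t) * B (of_real q * t) - a * b * t * B (of_real q ^ 2 * t)) / (1 + t)"
proof (cases "norm t < 1")
  case True
  assume "t \<noteq> -1"
  hence "1 + t \<noteq> 0" by (metis add.inverse_unique)
  thus ?thesis
    using True B_eq_series[of t] B_eq_series[of "of_real q * t"] B_eq_series[of "of_real q ^ 2 * t"]
      series_functional_equation[OF True] norm_q_mult_less[OF True] norm_q2_mult_less[OF True]
    by (simp add: nonzero_eq_divide_eq mult.commute)
next
  case False
  thus ?thesis using q by (subst qBorel_cont.simps) auto
qed

text \<open>Induction along the recursion of \<open>qBorel_cont\<close>, with the parameters fixed.\<close>
lemma scale_induct [case_names step]:
  assumes "\<And>t :: complex. (1 \<le> norm t \<Longrightarrow> P (of_real q * t)) \<Longrightarrow> (1 \<le> norm t \<Longrightarrow> P (of_real q ^ 2 * t)) \<Longrightarrow> P t"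
  shows "P t"
proof -
  have "q' = q \<longrightarrow> P t" for q' and a' b' :: complex
    by (induction q' a' b' t rule: qBorel_cont.induct) (use assms q in auto)
  thus ?thesis by blast
qed

lemma not_pole_scale:
  assumes "t \<notin> range pole"
  shows "of_real q * t \<notin> range pole"
proof
  assume "of_real q * t \<in> range pole"
  then obtain j where "of_real q * t = pole j" by blast
  hence "t = pole (Suc j)" using q by (simp add: field_simps)
  with assms show False by blast
qed

lemma not_pole_scale2: "t \<notin> range pole \<Longrightarrow> of_real q ^ 2 * t \<notin> range pole"
  using not_pole_scale[OF not_pole_scale, of t] by (simp add: power2_eq_square mult.assoc)

lemma norm_pole: "norm (pole j) = 1 / q ^ j"
  using q by (simp add: norm_divide norm_power)

lemma norm_pole_ge_1: "norm (pole j) \<ge> 1"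
  unfolding norm_pole using q by (simp add: power_le_one)

lemma small_not_pole: "norm t < 1 \<Longrightarrow> t \<notin> range pole"
proof
  assume t: "norm t < 1" "t \<in> range pole"
  then obtain j where "t = pole j" by blast
  with t(1) norm_pole_ge_1[of j] show False by simp
qed

lemma eventually_B_functional_equation:
  assumes "t \<noteq> -1"
  shows "eventually (\<lambda>t. B t = ((1 + (a + b) * t) * B (of_real q * t) - a * b * t * B (of_real q ^ 2 * t)) / (1 + t)) (nhds t)"
proof -
  have "eventually (\<lambda>t. t \<noteq> -1) (nhds t)"
    using assms by (rule t1_space_nhds)
  thus ?thesis by eventually_elim (rule B_functional_equation)
qed

lemma B_analytic_small:
  assumes "norm t < 1"
  shows "B analytic_on {t}"
proof -
  have "qBorel_series q a b holomorphic_on ball 0 1"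
  proof (rule power_series_holomorphic)
    fix w :: complex assume "w \<in> ball 0 1"
    hence "(\<lambda>n. coef n * (- w) ^ n) sums qBorel_series q a b w"
      by (intro series_sums) auto
    moreover have "coef n * (- w) ^ n = (coef n * (-1) ^ n) * (w - 0) ^ n" for n
      using power_mult_distrib[of "-1" w n] by simp
    ultimately show "(\<lambda>n. (coef n * (-1) ^ n) * (w - 0) ^ n) sums qBorel_series q a b w"
      by simp
  qed
  hence "B holomorphic_on ball 0 1"
    by (rule holomorphic_transform) (simp add: B_eq_series)
  thus ?thesis
    using assms holomorphic_on_imp_analytic_at[of B "ball 0 1" t] by simp
qed

lemma B_analytic: "t \<notin> range pole \<Longrightarrow> B analytic_on {t}"
proof (induction t rule: scale_induct)
  case (step t)
  show ?case
  proof (cases "norm t < 1")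
    case True
    thus ?thesis by (rule B_analytic_small)
  next
    case False
    hence t: "1 \<le> norm t" by simp
    have "t \<noteq> pole 0" using step.prems by blast
    hence t1: "t \<noteq> -1" by simp
    hence t1': "1 + t \<noteq> 0" by (metis add.inverse_unique)
    have 1: "(\<lambda>t. B (of_real q * t)) analytic_on {t}"
      by (rule analytic_at_scaled, rule step.IH(1)[OF t not_pole_scale[OF step.prems]])
    have 2: "(\<lambda>t. B (of_real q ^ 2 * t)) analytic_on {t}"
      by (rule analytic_at_scaled, rule step.IH(2)[OF t not_pole_scale2[OF step.prems]])
    have "(\<lambda>t. ((1 + (a + b) * t) * B (of_real q * t) - a * b * t * B (of_real q ^ 2 * t)) / (1 + t)) analytic_on {t}"
      using t1' by (intro analytic_intros 1 2) auto
    thus ?thesis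
      by (subst analytic_at_cong[OF eventually_B_functional_equation[OF t1] refl])
  qed
qed

lemma B_meromorphic_at: "B meromorphic_on {t}"
proof (induction t rule: scale_induct)
  case (step t)
  show ?case
  proof (cases "norm t < 1")
    case True
    thus ?thesis by (intro analytic_on_imp_meromorphic_on B_analytic_small)
  next
    case False
    hence t: "1 \<le> norm t" by simp
    have 1: "(\<lambda>t. B (of_real q * t)) meromorphic_on {t}"
      using step.IH(1)[OF t] by (rule meromorphic_on_compose) (auto intro!: analytic_intros)
    have 2: "(\<lambda>t. B (of_real q ^ 2 * t)) meromorphic_on {t}"
      using step.IH(2)[OF t] by (rule meromorphic_on_compose) (auto intro!: analytic_intros)
    have *: "(\<lambda>t. ((1 + (a + b) * t) * B (of_real q * t) - a * b * t * B (of_real q ^ 2 * t)) / (1 + t)) meromorphic_on {t}"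
      by (intro meromorphic_intros 1 2)
    have "eventually (\<lambda>w. w \<noteq> -1) (at t)"
      by (metis eventually_at_topological eventually_neq_at_within)
    hence "eventually (\<lambda>t. B t = ((1 + (a + b) * t) * B (of_real q * t) - a * b * t * B (of_real q ^ 2 * t)) / (1 + t)) (at t)"
      by eventually_elim (rule B_functional_equation)
    with * show ?thesis
      by (subst meromorphic_on_cong) auto
  qed
qed

lemma B_meromorphic: "B meromorphic_on UNIV"
  using B_meromorphic_at meromorphic_on_meromorphic_at by blast

end

text \<open>
  The identity theorem. The values agree as well as the germs, because a nicely meromorphic function
  is determined at each point by its punctured germ: by its limit, or by the convention \<open>0\<close> at a
  pole.
\<close>
lemma nicely_meromorphic_eqI:
  assumes f: "f nicely_meromorphic_on UNIV" and g: "g nicely_meromorphic_on UNIV"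
    and ev: "eventually (\<lambda>z. f z = g z) (at z0)"
  shows "f = g"
proof
  fix w
  have mero: "(\<lambda>z. f z - g z) meromorphic_on UNIV"
    using f g by (intro meromorphic_intros) (auto simp: nicely_meromorphic_on_def)
  define h where "h = remove_sings (\<lambda>z. f z - g z)"
  have h: "h nicely_meromorphic_on UNIV"
    unfolding h_def using mero by (rule remove_sings_nicely_meromorphic)
  have evh: "eventually (\<lambda>z. h z = f z - g z) (at x)" for x
    unfolding h_def using mero
    by (intro eventually_remove_sings_eq_at) (auto simp: meromorphic_on_altdef)
  have "eventually (\<lambda>z. h z = 0) (at z0)"
    using evh[of z0] ev by eventually_elim simp
  hence freq: "frequently (\<lambda>z. h z = 0) (at z0)"
    by (rule eventually_frequently[rotated]) auto
  have h0: "h z = 0" for z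
    by (rule frequently_eq_meromorphic_imp_constant[OF freq h]) auto
  have eq: "eventually (\<lambda>z. f z = g z) (at w)"
    using evh[of w] by eventually_elim (simp add: h0)
  have pole: "is_pole f w \<longleftrightarrow> is_pole g w"
    by (rule is_pole_cong[OF eq refl])
  show "f w = g w"
  proof (cases "is_pole f w")
    case True
    have "\<not> f \<midarrow>w\<rightarrow> f w" "\<not> g \<midarrow>w\<rightarrow> g w"
      using True pole by (auto simp: is_pole_def dest: not_tendsto_and_filterlim_at_infinity[rotated])
    hence "f w = 0" "g w = 0" using f g unfolding nicely_meromorphic_on_def by blast+
    thus ?thesis by simp
  next
    case False
    have ff: "f \<midarrow>w\<rightarrow> f w" and gg: "g \<midarrow>w\<rightarrow> g w"
      using f g pole False unfolding nicely_meromorphic_on_def by blast+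
    have "g \<midarrow>w\<rightarrow> f w"
      using ff tendsto_cong[OF eq] by simp
    thus ?thesis using gg by (rule LIM_unique)
  qed
qed

context q_params
begin

lemma qBorel_eq_remove_sings: "qBorel q a b = remove_sings B"
  unfolding qBorel_def
proof (rule the_equality)
  show *: "remove_sings B nicely_meromorphic_on UNIV \<and> (\<forall>t. norm t < 1 \<longrightarrow> remove_sings B t = qBorel_series q a b t)"
    using B_meromorphic remove_sings_nicely_meromorphic B_analytic_small B_eq_series by simp
  fix g assume g: "g nicely_meromorphic_on UNIV \<and> (\<forall>t. norm t < 1 \<longrightarrow> g t = qBorel_series q a b t)"
  have "eventually (\<lambda>t. t \<in> ball 0 1) (at (0::complex))"
    by (intro eventually_at_in_open') auto
  hence ev: "eventually (\<lambda>t. g t = remove_sings B t) (at 0)"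
    by eventually_elim (use g * in auto)
  thus "g = remove_sings B"
    using nicely_meromorphic_eqI[OF _ _ ev] g * by blast
qed

lemma qBorel_eq_B: "t \<notin> range pole \<Longrightarrow> qBorel q a b t = B t"
  unfolding qBorel_eq_remove_sings by (rule remove_sings_at_analytic, erule B_analytic)

section \<open>The residues\<close>

lemma isCont_B: "t \<notin> range pole \<Longrightarrow> isCont B t"
  by (rule analytic_at_imp_isCont, erule B_analytic)

lemma isCont_B_scaled:
  assumes "c * t \<notin> range pole"
  shows "isCont (\<lambda>t. B (c * t)) t"
proof (rule isCont_o2[where f = "\<lambda>t. c * t" and g = B])
  show "isCont B (c * t)" using assms by (rule isCont_B)
qed simp

lemma tendsto_scaled:
  fixes c :: complex
  assumes "c \<noteq> 0" "(g \<longlongrightarrow> l) (at (c * x))"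
  shows "((\<lambda>t. g (c * t)) \<longlongrightarrow> l) (at x)"
proof -
  have "((\<lambda>t. c * t) \<longlongrightarrow> c * x) (at x)"
    by (intro tendsto_mult tendsto_const tendsto_ident_at)
  moreover have "eventually (\<lambda>w. c * w = c * x \<longrightarrow> g (c * x) = l) (at x)"
    using eventually_neq_at_within[of x] by eventually_elim (use assms(1) in simp)
  ultimately show ?thesis
    using tendsto_compose_at[OF _ assms(2)] unfolding o_def by blast
qed

lemma of_real_q_nonzero: "complex_of_real q \<noteq> 0" using q by simp

text \<open>
  One step of the recurrence for the residues. The limit of the second summand is a
  hypothesis, since \<open>q\<^sup>2 p\<close> is a pole only from the third pole on; for the second pole
  it is a regular point, which corresponds to the convention \<open>d\<^sub>-\<^sub>1 = 0\<close>.
\<close>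
lemma pole_step:
  fixes j :: nat
  defines "p \<equiv> pole (Suc j)"
  assumes 1: "((\<lambda>t. (t - pole j) * B t) \<longlongrightarrow> r1) (at (pole j))"
    and 2: "((\<lambda>t. (t - p) * B (of_real q ^ 2 * t)) \<longlongrightarrow> r2) (at p)"
  shows "((\<lambda>t. (t - p) * B t) \<longlongrightarrow> ((1 + (a + b) * p) * (r1 / of_real q) - a * b * p * r2) / (1 + p)) (at p)"
proof -
  have "q * q ^ j < 1" using q power_Suc_less_one[of q j] by simp
  hence "norm p > 1" unfolding p_def norm_pole using q by simp
  hence p1: "p \<noteq> -1" "1 + p \<noteq> 0"
    by (auto simp: add_eq_0_iff)
  have qp: "of_real q * p = pole j"
    using q by (simp add: p_def)
  have "((\<lambda>t. (of_real q * t - pole j) * B (of_real q * t)) \<longlongrightarrow> r1) (at p)"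
    using tendsto_scaled[OF of_real_q_nonzero, where g = "\<lambda>t. (t - pole j) * B t" and l = r1 and x = p] 1
    unfolding qp .
  hence 1: "((\<lambda>t. (of_real q * t - pole j) * B (of_real q * t) / of_real q) \<longlongrightarrow> r1 / of_real q) (at p)"
    using of_real_q_nonzero by (intro tendsto_intros)
  have "((\<lambda>t. ((1 + (a + b) * t) * ((of_real q * t - pole j) * B (of_real q * t) / of_real q)
          - a * b * t * ((t - p) * B (of_real q ^ 2 * t))) / (1 + t)) \<longlongrightarrow>
       ((1 + (a + b) * p) * (r1 / of_real q) - a * b * p * r2) / (1 + p)) (at p)"
    by (intro tendsto_intros 1 2 p1)
  moreover have "eventually (\<lambda>t. t \<noteq> -1) (at p)"
    using t1_space_nhds[OF p1(1)] by (simp add: eventually_at_filter eventually_mono)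
  hence "eventually (\<lambda>t. ((1 + (a + b) * t) * ((of_real q * t - pole j) * B (of_real q * t) / of_real q)
          - a * b * t * ((t - p) * B (of_real q ^ 2 * t))) / (1 + t) = (t - p) * B t) (at p)"
  proof eventually_elim
    case (elim t)
    have "(of_real q * t - pole j) / of_real q = t - p"
      using q by (simp add: p_def field_simps)
    hence e: "(of_real q * t - pole j) * B (of_real q * t) / of_real q = (t - p) * B (of_real q * t)"
      by (metis times_divide_eq_left)
    show ?case
      unfolding e B_functional_equation[OF elim] times_divide_eq_right
      by (rule arg_cong[where f = "\<lambda>x. x / (1 + t)"]) (simp add: algebra_simps)
  qed
  ultimately show ?thesis by (rule Lim_transform_eventually)
qed

lemma pole_limit_0: "((\<lambda>t. (t - pole 0) * B t) \<longlongrightarrow> d 0 / of_real q ^ 0) (at (pole 0))"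
proof -
  let ?N = "\<lambda>t. (1 + (a + b) * t) * B (of_real q * t) - a * b * t * B (of_real q ^ 2 * t)"
  have n: "norm (- complex_of_real q) < 1" "norm (- (complex_of_real q ^ 2)) < 1"
    using q by (auto simp: norm_power power_less_one_iff)
  have c: "of_real q * (-1) \<notin> range pole" "of_real q ^ 2 * (-1) \<notin> range pole"
    using small_not_pole[OF n(1)] small_not_pole[OF n(2)] by simp_all
  have "isCont ?N (-1)"
    by (intro continuous_intros isCont_B_scaled c)
  hence "(?N \<longlongrightarrow> ?N (-1)) (at (-1))"
    by (simp add: isCont_def)
  moreover have "?N (-1) = d 0"
    using d_0_eq B_eq_series[OF n(1)] B_eq_series[OF n(2)] by (simp del: d_coeff.simps)
  moreover have "eventually (\<lambda>t. ?N t = (t - pole 0) * B t) (at (-1))"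
    using eventually_neq_at_within[of "-1"]
  proof eventually_elim
    case (elim t)
    hence "1 + t \<noteq> 0" by (metis add.inverse_unique)
    thus ?case by (subst B_functional_equation[OF elim]) (simp add: add.commute)
  qed
  ultimately have "((\<lambda>t. (t - pole 0) * B t) \<longlongrightarrow> d 0) (at (-1))"
    using Lim_transform_eventually by (simp del: d_coeff.simps)
  thus ?thesis by (simp del: d_coeff.simps)
qed

lemma pole_limit: "((\<lambda>t. (t - pole j) * B t) \<longlongrightarrow> d j / of_real q ^ j) (at (pole j))"
proof (induction j rule: induct_nat_012)
  case 0
  show ?case by (rule pole_limit_0)
next
  case 1
  let ?p = "pole (Suc 0)"
  have qp: "of_real q ^ 2 * ?p = - of_real q"
    using q by (simp add: power2_eq_square)
  have "of_real q ^ 2 * ?p \<notin> range pole"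
    unfolding qp by (intro small_not_pole) (use q in auto)
  hence "isCont (\<lambda>t. (t - ?p) * B (of_real q ^ 2 * t)) ?p"
    by (intro continuous_intros isCont_B_scaled)
  hence "((\<lambda>t. (t - ?p) * B (of_real q ^ 2 * t)) \<longlongrightarrow> 0) (at ?p)"
    by (simp add: isCont_def)
  from pole_step[OF pole_limit_0 this] show ?case
    by (simp add: field_simps del: d_coeff.simps(1))
next
  case (ge2 n)
  let ?p = "pole (Suc (Suc n))"
  have qp: "of_real q ^ 2 * ?p = pole n"
    using q by (simp add: power2_eq_square)
  have "((\<lambda>t. (of_real q ^ 2 * t - pole n) * B (of_real q ^ 2 * t)) \<longlongrightarrow> d n / of_real q ^ n) (at ?p)"
    using tendsto_scaled[where c = "of_real q ^ 2" and g = "\<lambda>t. (t - pole n) * B t" and x = ?p] ge2(1) of_real_q_nonzero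
    unfolding qp by simp
  hence "((\<lambda>t. (of_real q ^ 2 * t - pole n) * B (of_real q ^ 2 * t) / of_real q ^ 2)
           \<longlongrightarrow> d n / of_real q ^ n / of_real q ^ 2) (at ?p)"
    using of_real_q_nonzero by (intro tendsto_intros) auto
  moreover have "(of_real q ^ 2 * t - pole n) * B (of_real q ^ 2 * t) / of_real q ^ 2 = (t - ?p) * B (of_real q ^ 2 * t)" for t
    using q by (simp add: field_simps power2_eq_square)
  ultimately have "((\<lambda>t. (t - ?p) * B (of_real q ^ 2 * t)) \<longlongrightarrow> d n / of_real q ^ n / of_real q ^ 2) (at ?p)"
    by simp
  from pole_step[OF ge2(2) this]
  have "((\<lambda>t. (t - ?p) * B t) \<longlongrightarrow> ((1 + (a + b) * ?p) * (d (Suc n) / of_real q ^ Suc n / of_real q)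
           - a * b * ?p * (d n / of_real q ^ n / of_real q ^ 2)) / (1 + ?p)) (at ?p)" .
  also have "((1 + (a + b) * ?p) * (d (Suc n) / of_real q ^ Suc n / of_real q)
           - a * b * ?p * (d n / of_real q ^ n / of_real q ^ 2)) / (1 + ?p)
      = ((1 - (a + b) / of_real q ^ (n + 2)) * d (Suc n) + a * b / of_real q ^ (n + 2) * d n)
           / (1 - 1 / of_real q ^ (n + 2)) / of_real q ^ (n + 2)"
  proof -
    have "((1 + (a + b) * ?p) * (d (Suc n) / of_real q ^ Suc n / of_real q)
           - a * b * ?p * (d n / of_real q ^ n / of_real q ^ 2))
       = ((1 - (a + b) / of_real q ^ (n + 2)) * d (Suc n) + a * b / of_real q ^ (n + 2) * d n) / of_real q ^ (n + 2)"
      using of_real_q_nonzero by (simp add: field_simps power2_eq_square del: d_coeff.simps)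
    thus ?thesis by (simp add: field_simps del: d_coeff.simps)
  qed
  also have "\<dots> = d (Suc (Suc n)) / of_real q ^ Suc (Suc n)"
    by simp
  finally show ?case .
qed

section \<open>Polynomial growth away from the poles\<close>

text \<open>
  The points at which no step of the recursion divides by a small number: the distance of
  \<open>q ^ k t\<close> from \<open>- 1\<close> is comparable to \<open>max 1 \<bar>q ^ k t\<bar>\<close>. The set is closed under multiplication by
  \<open>q\<close>, and it contains the positive half-line and the circles half-way (in logarithmic scale) between
  consecutive poles; the constant is the one that works for these circles.
\<close>
definition admissible :: "complex \<Rightarrow> bool" where
  "admissible t \<longleftrightarrow> (\<forall>k. (1 - sqrt q) * max 1 (q ^ k * norm t) \<le> norm (1 + of_real q ^ k * t))"

lemma sqrt_q: "0 < sqrt q" "sqrt q < 1" "sqrt q * sqrt q = q"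
  using q by auto

lemma q_power: "0 < q ^ k" "q ^ k \<le> 1"
  using q by (auto simp: power_le_one)

lemma admissible_scale: "admissible t \<Longrightarrow> admissible (of_real q * t)"
  unfolding admissible_def
proof
  fix k assume "\<forall>k. (1 - sqrt q) * max 1 (q ^ k * norm t) \<le> norm (1 + of_real q ^ k * t)"
  from this[rule_format, of "Suc k"] q
  show "(1 - sqrt q) * max 1 (q ^ k * norm (of_real q * t)) \<le> norm (1 + of_real q ^ k * (of_real q * t))"
    by (simp add: norm_mult mult_ac)
qed

lemma admissible_scale2: "admissible t \<Longrightarrow> admissible (of_real q ^ 2 * t)"
  using admissible_scale[OF admissible_scale, of t] by (simp add: power2_eq_square mult.assoc)

lemma admissible_not_pole:
  assumes "admissible t"
  shows "t \<notin> range pole"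
proof
  assume "t \<in> range pole"
  then obtain j where "t = pole j" by blast
  hence "1 + of_real q ^ j * t = 0" using q by simp
  hence "(1 - sqrt q) * max 1 (q ^ j * norm t) \<le> 0"
    using assms unfolding admissible_def by (metis norm_zero)
  moreover have "(1 - sqrt q) * max 1 (q ^ j * norm t) > 0"
    using sqrt_q by (intro mult_pos_pos) auto
  ultimately show False by linarith
qed

lemma admissible_pos:
  assumes "t > 0"
  shows "admissible (of_real t)"
  unfolding admissible_def
proof
  fix k
  have "q ^ k * t > 0" using assms q_power by simp
  hence "(1 - sqrt q) * max 1 (q ^ k * t) \<le> 1 * (1 + q ^ k * t)"
    using sqrt_q by (intro mult_mono) auto
  also have "1 * (1 + q ^ k * t) = norm (1 + of_real q ^ k * of_real t :: complex)"
    using norm_of_real[of "1 + q ^ k * t", where 'a = complex] \<open>q ^ k * t > 0\<close> by simp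
  finally show "(1 - sqrt q) * max 1 (q ^ k * norm (of_real t :: complex)) \<le> norm (1 + of_real q ^ k * of_real t :: complex)"
    using assms by simp
qed

lemma admissible_small_aux:
  fixes t :: complex
  assumes "q ^ k * norm t \<le> sqrt q"
  shows "(1 - sqrt q) * max 1 (q ^ k * norm t) \<le> norm (1 + of_real q ^ k * t)"
proof -
  have n: "norm (of_real q ^ k * t) = q ^ k * norm t"
    using q by (simp add: norm_mult norm_power)
  have "q ^ k * norm t \<le> 1" using assms sqrt_q(2) by linarith
  hence "max 1 (q ^ k * norm t) = 1" by simp
  moreover have "norm (1 + of_real q ^ k * t) \<ge> 1 - norm (of_real q ^ k * t)"
    using norm_triangle_ineq2[of 1 "- (of_real q ^ k * t)"] by simp
  ultimately show ?thesis unfolding n using assms by simp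
qed

lemma admissible_small:
  assumes "norm t \<le> sqrt q"
  shows "admissible t"
  unfolding admissible_def
proof
  fix k
  have "q ^ k * norm t \<le> 1 * norm t"
    using q_power by (intro mult_right_mono) auto
  with assms show "(1 - sqrt q) * max 1 (q ^ k * norm t) \<le> norm (1 + of_real q ^ k * t)"
    by (intro admissible_small_aux) simp
qed

lemma admissible_circle:
  assumes "norm t = 1 / (q ^ n * sqrt q)"
  shows "admissible t"
  unfolding admissible_def
proof
  fix k
  define y where "y = q ^ k * norm t"
  have n: "norm (of_real q ^ k * t) = y"
    using q by (simp add: norm_mult norm_power y_def)
  have nt: "norm t * (q ^ n * sqrt q) = 1"
    using assms q_power sqrt_q by simp
  show "(1 - sqrt q) * max 1 (q ^ k * norm t) \<le> norm (1 + of_real q ^ k * t)"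
  proof (cases "k \<le> n")
    case True
    have "q ^ n \<le> q ^ k" using q True by (intro power_decreasing) auto
    hence "norm t * (q ^ n * sqrt q) \<le> norm t * (q ^ k * sqrt q)"
      using sqrt_q by (intro mult_left_mono mult_right_mono) auto
    hence y: "1 \<le> y * sqrt q" unfolding nt y_def by (simp add: mult_ac)
    have "y \<ge> 0" unfolding n[symmetric] by simp
    hence "y * sqrt q \<le> y * 1" using sqrt_q by (intro mult_left_mono) auto
    with y have "max 1 y = y" by simp
    moreover have "norm (1 + of_real q ^ k * t) \<ge> y - 1"
      using norm_triangle_ineq2[of "of_real q ^ k * t" "-1"] n by (simp add: add.commute)
    ultimately show ?thesis using y unfolding y_def[symmetric] by (simp add: algebra_simps)
  next
    case False
    hence "q ^ k \<le> q ^ Suc n" using q by (intro power_decreasing) auto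
    hence "q ^ k * norm t \<le> q ^ Suc n * norm t" by (intro mult_right_mono) auto
    also have "\<dots> = (sqrt q * sqrt q) * q ^ n * norm t"
      unfolding sqrt_q(3) by simp
    also have "\<dots> = sqrt q * (norm t * (q ^ n * sqrt q))"
      by (simp only: mult_ac)
    also have "\<dots> = sqrt q" unfolding nt by simp
    finally show ?thesis by (rule admissible_small_aux)
  qed
qed

lemma B_step_bound:
  assumes "admissible t"
  shows "norm (B t) \<le> (1 + norm (a + b) + norm (a * b)) / (1 - sqrt q)
            * (norm (B (of_real q * t)) + norm (B (of_real q ^ 2 * t)))"
proof -
  define M where "M = max 1 (norm t)"
  define D where "D = 1 - sqrt q"
  define A where "A = 1 + norm (a + b) + norm (a * b)"
  define X Y where "X = B (of_real q * t)" and "Y = B (of_real q ^ 2 * t)"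
  have D: "D > 0" and M: "M \<ge> 1" "norm t \<le> M" using sqrt_q by (auto simp: D_def M_def)
  have le: "D * M \<le> norm (1 + t)"
    using assms unfolding admissible_def D_def M_def by (metis mult_1 power_0)
  have pos: "D * M > 0" using D M by simp
  have "t \<noteq> -1"
    using le pos by auto
  hence "norm (B t) = norm ((1 + (a + b) * t) * X - a * b * t * Y) / norm (1 + t)"
    unfolding X_def Y_def by (subst B_functional_equation) (simp_all add: norm_divide)
  also have "\<dots> \<le> (A * M * (norm X + norm Y)) / (D * M)"
  proof (intro frac_le le pos)
    have "norm (1 + (a + b) * t) \<le> 1 + norm (a + b) * norm t"
      using norm_triangle_ineq[of 1 "(a + b) * t"] by (simp add: norm_mult)
    also have "\<dots> \<le> M + norm (a + b) * M + norm (a * b) * M"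
      using M by (intro add_increasing2 add_mono mult_left_mono) auto
    also have "\<dots> = A * M" by (simp add: A_def algebra_simps)
    finally have 1: "norm (1 + (a + b) * t) \<le> A * M" .
    have "norm (a * b * t) \<le> norm (a * b) * M"
      using M by (simp add: norm_mult mult_left_mono)
    also have "\<dots> \<le> A * M"
      using M by (intro mult_right_mono) (auto simp: A_def)
    finally have 2: "norm (a * b * t) \<le> A * M" .
    have "norm ((1 + (a + b) * t) * X - a * b * t * Y) \<le> norm (1 + (a + b) * t) * norm X + norm (a * b * t) * norm Y"
      using norm_triangle_ineq4 by (metis norm_mult)
    also have "\<dots> \<le> A * M * norm X + A * M * norm Y"
      by (intro add_mono mult_right_mono 1 2) auto
    finally show "norm ((1 + (a + b) * t) * X - a * b * t * Y) \<le> A * M * (norm X + norm Y)"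
      by (simp add: algebra_simps)
    show "0 \<le> A * M * (norm X + norm Y)" using M by (simp add: A_def)
  qed
  also have "\<dots> = A / D * (norm X + norm Y)"
    using M by simp
  finally show ?thesis unfolding A_def D_def X_def Y_def .
qed

lemma B_bounded_small: "\<exists>C\<ge>0. \<forall>t. norm t \<le> sqrt q \<longrightarrow> norm (B t) \<le> C"
proof -
  have "continuous_on (cball 0 (sqrt q)) B"
  proof (rule continuous_at_imp_continuous_on, rule ballI)
    fix t :: complex assume "t \<in> cball 0 (sqrt q)"
    hence "norm t \<le> sqrt q" by simp
    hence "norm t < 1" using sqrt_q(2) by linarith
    thus "isCont B t" by (intro isCont_B small_not_pole)
  qed
  hence "compact (B ` cball 0 (sqrt q))"
    by (rule compact_continuous_image) simp
  hence "bounded (B ` cball 0 (sqrt q))"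
    by (rule compact_imp_bounded)
  then obtain C where "\<forall>x\<in>B ` cball 0 (sqrt q). norm x \<le> C"
    unfolding bounded_iff by blast
  hence C: "norm (B t) \<le> C" if "norm t \<le> sqrt q" for t
    using that by simp
  moreover have "C \<ge> 0"
    using order_trans[OF norm_ge_zero C[of 0]] q by simp
  ultimately show ?thesis by blast
qed

text \<open>
  A recursion step loses at most the factor \<open>2 K\<close> and shrinks \<open>\<bar>t\<bar>\<close> at least by the factor \<open>q\<close>, so the
  bound by \<open>\<bar>t\<bar> ^ m\<close> propagates outwards once \<open>2 K q ^ m \<le> 1\<close>. Small \<open>t\<close> have to be treated
  separately because \<open>\<bar>t\<bar> ^ m\<close> vanishes at the origin: the induction starts with the annulus
  \<open>r \<le> \<bar>t\<bar> \<le> sqrt q\<close>, wide enough to catch \<open>q\<^sup>2 t\<close> when \<open>\<bar>t\<bar>\<close> exceeds \<open>sqrt q\<close>.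
\<close>
lemma B_growth: "\<exists>C m. C \<ge> 0 \<and> (\<forall>t. admissible t \<longrightarrow> norm (B t) \<le> C * (1 + norm t ^ m))"
proof -
  define K where "K = (1 + norm (a + b) + norm (a * b)) / (1 - sqrt q)"
  have K: "K > 0" unfolding K_def using sqrt_q by (intro divide_pos_pos add_pos_nonneg) auto
  obtain C0 where C0: "C0 \<ge> 0" "\<And>t. norm t \<le> sqrt q \<Longrightarrow> norm (B t) \<le> C0"
    using B_bounded_small by blast
  obtain m where "q ^ m < 1 / (2 * K)"
    using real_arch_pow_inv[of "1 / (2 * K)" q] K q by auto
  hence m: "2 * K * q ^ m \<le> 1" using K by (simp add: field_simps)
  define r where "r = q\<^sup>2 * sqrt q"
  have r: "r > 0" "r \<le> sqrt q"
    using q sqrt_q q_power[of 2] by (auto simp: r_def mult_left_le_one_le)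
  define C1 where "C1 = C0 / r ^ m"
  have C1: "C1 \<ge> 0" using C0 r by (simp add: C1_def)
  have base: "norm (B t) \<le> C1 * norm t ^ m" if "r \<le> norm t" "norm t \<le> sqrt q" for t
  proof -
    have "norm (B t) \<le> C0" using C0 that by blast
    also have "\<dots> = C1 * r ^ m" using r by (simp add: C1_def)
    also have "\<dots> \<le> C1 * norm t ^ m" using that r C1 by (intro mult_left_mono power_mono) auto
    finally show ?thesis .
  qed
  have step: "norm (B t) \<le> C1 * norm t ^ m"
    if "admissible t" "r \<le> norm t" "q ^ n * norm t \<le> sqrt q" for n t
    using that
  proof (induction n arbitrary: t)
    case 0
    thus ?case using base by simp
  next
    case (Suc n)
    show ?case
    proof (cases "norm t \<le> sqrt q")
      case True
      thus ?thesis using base Suc.prems by blast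
    next
      case False
      have n1: "norm (of_real q * t) = q * norm t" and n2: "norm (of_real q ^ 2 * t) = q\<^sup>2 * norm t"
        using q by (auto simp: norm_mult norm_power)
      have q2: "q\<^sup>2 \<le> q" using q by (simp add: power2_eq_square)
      have ge: "r \<le> q\<^sup>2 * norm t"
        unfolding r_def using False by (intro mult_left_mono) auto
      have le: "q\<^sup>2 * norm t \<le> q * norm t"
        using q2 by (intro mult_right_mono) auto
      have le1: "q ^ n * (q * norm t) \<le> sqrt q"
        using Suc.prems(3) by (simp add: mult_ac)
      have "q ^ n * (q\<^sup>2 * norm t) \<le> q ^ n * (q * norm t)"
        using le q_power[of n] by (intro mult_left_mono) auto
      with le1 have le2: "q ^ n * (q\<^sup>2 * norm t) \<le> sqrt q" by linarith
      have "norm (B t) \<le> K * (norm (B (of_real q * t)) + norm (B (of_real q ^ 2 * t)))"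
        unfolding K_def by (rule B_step_bound) fact
      also have "norm (B (of_real q * t)) \<le> C1 * norm (of_real q * t) ^ m"
        using ge le le1 by (intro Suc.IH admissible_scale Suc.prems) (simp_all only: n1)
      also have "norm (B (of_real q ^ 2 * t)) \<le> C1 * norm (of_real q ^ 2 * t) ^ m"
        using ge le2 by (intro Suc.IH admissible_scale2 Suc.prems) (simp_all only: n2)
      also have "\<dots> \<le> C1 * norm (of_real q * t) ^ m"
        unfolding n1 n2 using le C1 q by (intro mult_left_mono power_mono) auto
      also have "K * (C1 * norm (of_real q * t) ^ m + C1 * norm (of_real q * t) ^ m)
          = (2 * K * q ^ m) * (C1 * norm t ^ m)"
        unfolding n1 by (simp add: power_mult_distrib mult_ac)
      also have "\<dots> \<le> 1 * (C1 * norm t ^ m)"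
        using m C1 by (intro mult_right_mono) auto
      finally show ?thesis using K by simp
    qed
  qed
  have "norm (B t) \<le> (C0 + C1) * (1 + norm t ^ m)" if "admissible t" for t
  proof (cases "norm t \<le> sqrt q")
    case True
    have "norm (B t) \<le> C0 * 1" using C0(2)[OF True] by simp
    also have "\<dots> \<le> (C0 + C1) * (1 + norm t ^ m)"
      using C0 C1 by (intro mult_mono) auto
    finally show ?thesis .
  next
    case False
    hence t: "norm t > 0" using sqrt_q by linarith
    obtain n where "q ^ n < sqrt q / norm t"
      using real_arch_pow_inv[of "sqrt q / norm t" q] sqrt_q t q by auto
    hence "q ^ n * norm t \<le> sqrt q" using t by (simp add: field_simps)
    hence "norm (B t) \<le> C1 * norm t ^ m"
      using False r that by (intro step) auto
    also have "\<dots> \<le> (C0 + C1) * (1 + norm t ^ m)"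
      using C0 C1 by (intro mult_mono) auto
    finally show ?thesis .
  qed
  thus ?thesis using C0 C1 by (intro exI[of _ "C0 + C1"] exI[of _ m]) auto
qed

section \<open>The integrals\<close>

definition L :: real where "L = - ln q"

lemma L_pos: "L > 0" using q by (simp add: L_def)

lemma ln_q: "ln q = - L" by (simp add: L_def)

lemma norm_Eq:
  "norm (Eq q (s - z)) = exp (((Im s - Im z)\<^sup>2 - (Re s - (Re z + ln (sqrt q)))\<^sup>2) / (2 * L))"
proof -
  have dist: "2 * complex_of_real (ln q) = of_real (2 * ln q)" by simp
  have "Re ((s - z - of_real (ln (sqrt q))) ^ 2 / (2 * of_real (ln q)))
     = ((Re s - (Re z + ln (sqrt q)))\<^sup>2 - (Im s - Im z)\<^sup>2) / (2 * ln q)"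
    unfolding dist Re_divide_of_real Re_power2 by (simp add: diff_diff_eq)
  also have "\<dots> = ((Im s - Im z)\<^sup>2 - (Re s - (Re z + ln (sqrt q)))\<^sup>2) / (2 * L)"
    using L_pos unfolding ln_q by (simp add: field_simps)
  finally show ?thesis unfolding Eq_def by (simp add: norm_exp_eq_Re)
qed

text \<open>On horizontal strips the Gaussian beats every exponential; the bound completes the square.\<close>
lemma Eq_decay:
  "\<exists>M. \<forall>s. \<bar>Im s\<bar> \<le> Y \<longrightarrow> norm (Eq q (s - z)) * exp (\<kappa> * Re s) \<le> M"
proof (intro exI allI impI)
  fix s :: complex assume s: "\<bar>Im s\<bar> \<le> Y"
  define x0 where "x0 = Re z + ln (sqrt q)"
  define x where "x = Re s - x0"
  have "\<bar>Im s - Im z\<bar> \<le> Y + \<bar>Im z\<bar>" using s by linarith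
  hence y: "(Im s - Im z)\<^sup>2 \<le> (Y + \<bar>Im z\<bar>)\<^sup>2"
    using abs_le_square_iff by force
  have "0 \<le> (x - \<kappa> * L)\<^sup>2" by simp
  hence x: "2 * L * \<kappa> * x - x\<^sup>2 \<le> (\<kappa> * L)\<^sup>2"
    by (simp add: power2_eq_square algebra_simps)
  have "norm (Eq q (s - z)) * exp (\<kappa> * Re s) = exp (((Im s - Im z)\<^sup>2 - x\<^sup>2) / (2 * L) + \<kappa> * Re s)"
    unfolding norm_Eq x0_def x_def by (simp add: exp_add)
  also have "((Im s - Im z)\<^sup>2 - x\<^sup>2) / (2 * L) + \<kappa> * Re s
      = ((Im s - Im z)\<^sup>2 + (2 * L * \<kappa> * x - x\<^sup>2)) / (2 * L) + \<kappa> * x0"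
    using L_pos by (simp add: x_def field_simps)
  also have "\<dots> \<le> ((Y + \<bar>Im z\<bar>)\<^sup>2 + (\<kappa> * L)\<^sup>2) / (2 * L) + \<kappa> * x0"
    using x y L_pos by (intro add_right_mono divide_right_mono add_mono) auto
  finally show "norm (Eq q (s - z)) * exp (\<kappa> * Re s)
      \<le> exp (((Y + \<bar>Im z\<bar>)\<^sup>2 + (\<kappa> * L)\<^sup>2) / (2 * L) + \<kappa> * (Re z + ln (sqrt q)))"
    unfolding x0_def by simp
qed

text \<open>The integrand in the variable \<open>s = ln t\<close>; the factor \<open>1 / t\<close> is absorbed by \<open>ds = dt / t\<close>.\<close>
definition log_integrand :: "complex \<Rightarrow> complex \<Rightarrow> complex" where
  "log_integrand z s = B (exp s) * Eq q (s - z)"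

text \<open>
  The factor \<open>e\<^sup>x + e\<^sup>-\<^sup>x\<close>, which is \<open>(1 + t\<^sup>2) / t\<close> on the positive half-line, serves both purposes:
  it dominates the integral by that of \<open>1 / (1 + t\<^sup>2)\<close>, and it makes the vertical sides of the
  rectangles small.
\<close>
lemma log_integrand_decay:
  "\<exists>M\<ge>0. \<forall>s. \<bar>Im s\<bar> \<le> 2 * pi \<longrightarrow> admissible (exp s) \<longrightarrow> norm (log_integrand z s) * (exp (Re s) + exp (- Re s)) \<le> M"
proof -
  obtain C m where C: "C \<ge> 0" "\<And>t. admissible t \<Longrightarrow> norm (B t) \<le> C * (1 + norm t ^ m)"
    using B_growth by blast
  obtain M where M: "\<And>\<kappa> s. \<bar>Im s\<bar> \<le> 2 * pi \<Longrightarrow> norm (Eq q (s - z)) * exp (\<kappa> * Re s) \<le> M \<kappa>"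
    using Eq_decay[of "2 * pi" z] by metis
  define M0 where "M0 = C * (M 1 + M (-1) + M (real m + 1) + M (real m - 1))"
  have *: "norm (log_integrand z s) * (exp (Re s) + exp (- Re s)) \<le> M0" if s: "\<bar>Im s\<bar> \<le> 2 * pi" "admissible (exp s)" for s
  proof -
    have "norm (log_integrand z s) * (exp (Re s) + exp (- Re s))
        = norm (B (exp s)) * (norm (Eq q (s - z)) * (exp (Re s) + exp (- Re s)))"
      by (simp add: log_integrand_def norm_mult)
    also have "\<dots> \<le> C * (1 + norm (exp s) ^ m) * (norm (Eq q (s - z)) * (exp (Re s) + exp (- Re s)))"
      using C(2)[OF s(2)] by (intro mult_right_mono) auto
    also have "\<dots> = C * (norm (Eq q (s - z)) * exp (1 * Re s) + norm (Eq q (s - z)) * exp ((-1) * Re s)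
        + norm (Eq q (s - z)) * exp ((real m + 1) * Re s) + norm (Eq q (s - z)) * exp ((real m - 1) * Re s))"
      by (simp add: norm_exp_eq_Re algebra_simps exp_add exp_diff exp_minus exp_of_nat2_mult divide_inverse)
    also have "\<dots> \<le> M0"
      unfolding M0_def by (intro mult_left_mono add_mono M s C)
    finally show ?thesis .
  qed
  have "norm (log_integrand z 0) * (exp (Re 0) + exp (- Re 0)) \<le> M0"
    using admissible_pos[of 1] by (intro *) auto
  hence "M0 \<ge> 0" by (smt (verit) exp_gt_zero mult_nonneg_nonneg norm_ge_zero)
  thus ?thesis using * by blast
qed

lemma log_integrand_analytic:
  assumes "exp s \<notin> range pole"
  shows "log_integrand z analytic_on {s}"
proof -
  have "exp analytic_on {s}"
    using holomorphic_on_exp open_UNIV UNIV_I by (rule holomorphic_on_imp_analytic_at)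
  hence "(\<lambda>s. B (exp s)) analytic_on {s}"
    using analytic_on_compose[of exp "{s}" B] B_analytic[OF assms] by (simp add: o_def)
  moreover have "(\<lambda>s. Eq q (s - z)) analytic_on {s}"
    unfolding Eq_def ln_q using L_pos by (auto intro!: analytic_intros)
  ultimately show ?thesis
    unfolding log_integrand_def by (intro analytic_on_mult)
qed

lemma isCont_log_integrand: "exp s \<notin> range pole \<Longrightarrow> isCont (log_integrand z) s"
  by (rule analytic_at_imp_isCont, erule log_integrand_analytic)

abbreviation integrand :: "complex \<Rightarrow> real \<Rightarrow> complex" where
  "integrand z t \<equiv> qBorel q a b (of_real t) * Eq q (surface_pt t 0 - z) / of_real t"

lemma integrand_eq:
  assumes "t > 0"
  shows "integrand z t = log_integrand z (of_real (ln t)) / of_real t"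
proof -
  have "qBorel q a b (of_real t) = B (of_real t)"
    by (intro qBorel_eq_B admissible_not_pole admissible_pos assms)
  moreover have "exp (complex_of_real (ln t)) = of_real t"
    unfolding exp_of_real using assms by simp
  moreover have "surface_pt t 0 = of_real (ln t)"
    by (simp add: surface_pt_def complex_eq_iff)
  ultimately show ?thesis by (simp add: log_integrand_def)
qed

lemma exp_real_not_pole: "exp (complex_of_real x) \<notin> range pole"
  unfolding exp_of_real by (intro admissible_not_pole admissible_pos) simp

lemma continuous_on_integrand: "continuous_on {0<..} (integrand z)"
proof -
  have "continuous_on {0<..} (\<lambda>t. log_integrand z (of_real (ln t)) / of_real t)"
  proof (rule continuous_at_imp_continuous_on, rule ballI)
    fix t :: real assume t: "t \<in> {0<..}"
    have "isCont (\<lambda>t. complex_of_real (ln t)) t"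
      using t by (intro continuous_intros) auto
    hence "isCont (\<lambda>t. log_integrand z (of_real (ln t))) t"
      using isCont_log_integrand[OF exp_real_not_pole] by (rule isCont_o2)
    thus "isCont (\<lambda>t. log_integrand z (of_real (ln t)) / of_real t) t"
      using t by (intro continuous_intros) auto
  qed
  thus ?thesis
    by (rule continuous_on_eq) (simp add: integrand_eq)
qed

lemma integrand_integrable: "set_integrable lborel {0<..} (integrand z)"
proof -
  obtain M where M: "\<And>s. \<bar>Im s\<bar> \<le> 2 * pi \<Longrightarrow> admissible (exp s) \<Longrightarrow> norm (log_integrand z s) * (exp (Re s) + exp (- Re s)) \<le> M"
    using log_integrand_decay by blast
  have "set_integrable lborel UNIV (\<lambda>x::real. inverse (1 + x\<^sup>2))"
    using integrable_inverse_1_plus_square by simp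
  hence *: "set_integrable lborel {0<..} (\<lambda>x::real. M * inverse (1 + x\<^sup>2))"
    by (intro set_integrable_mult_right) (rule set_integrable_subset, auto)
  show ?thesis
  proof (rule set_integrable_bound[OF *])
    show "set_borel_measurable lborel {0<..} (integrand z)"
      using borel_measurable_continuous_on_indicator[OF _ continuous_on_integrand, of z]
      by (simp add: set_borel_measurable_def)
    show "AE x in lborel. x \<in> {0<..} \<longrightarrow> norm (integrand z x) \<le> norm (M * inverse (1 + x\<^sup>2))"
    proof (intro AE_I2 impI)
      fix t :: real assume "t \<in> {0<..}"
      hence t: "t > 0" by simp
      have "norm (log_integrand z (of_real (ln t))) * (exp (Re (of_real (ln t))) + exp (- Re (of_real (ln t)))) \<le> M"
      proof (rule M)
        show "admissible (exp (of_real (ln t)))"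
          unfolding exp_of_real by (rule admissible_pos) simp
      qed simp
      hence "norm (log_integrand z (of_real (ln t))) * (t + inverse t) \<le> M"
        using t by (simp add: exp_minus)
      moreover have "norm (integrand z t) * (1 + t\<^sup>2) = norm (log_integrand z (of_real (ln t))) * (t + inverse t)"
        unfolding integrand_eq[OF t] using t by (simp add: norm_divide field_simps power2_eq_square)
      ultimately have "norm (integrand z t) * (1 + t\<^sup>2) \<le> M" by simp
      hence "norm (integrand z t) \<le> M * inverse (1 + t\<^sup>2)"
        by (simp add: field_simps add_pos_nonneg)
      thus "norm (integrand z t) \<le> norm (M * inverse (1 + t\<^sup>2))" by simp
    qed
  qed
qed

text \<open>
  Half-integer multiples of \<open>L\<close> keep the vertical lines \<open>Re s = X n\<close> half-way between the poles,
  whose real parts are the integer multiples.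
\<close>
definition X :: "nat \<Rightarrow> real" where "X n = (real n + 1 / 2) * L"

lemma X_pos: "X n > 0" using L_pos by (simp add: X_def)

lemma exp_L: "exp L = 1 / q" 
  using q by (simp add: L_def exp_minus divide_inverse)

lemma exp_X: "exp (X n) = 1 / (q ^ n * sqrt q)"
proof -
  have "sqrt q = exp (- (L / 2))"
    using q by (intro real_sqrt_unique) (simp_all add: L_def power2_eq_square flip: exp_add)
  moreover have "q ^ n = exp (- (real n * L))"
    using q by (simp add: L_def exp_of_nat_mult)
  ultimately have "q ^ n * sqrt q = exp (- X n)"
    by (simp add: X_def algebra_simps flip: exp_add)
  thus ?thesis by (simp add: exp_minus divide_inverse)
qed

lemma filterlim_X: "filterlim X at_top sequentially"
proof -
  have "filterlim (\<lambda>n. L * (1 / 2 + real n)) at_top sequentially"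
    using L_pos
    by (intro filterlim_tendsto_pos_mult_at_top[OF tendsto_const] filterlim_tendsto_add_at_top[OF tendsto_const]
          filterlim_real_sequentially)
  thus ?thesis by (simp add: X_def[abs_def] mult.commute add.commute)
qed

lemma X_mono: "m \<le> n \<Longrightarrow> X m \<le> X n"
  using L_pos by (simp add: X_def)

lemma admissible_vertical:
  assumes "Re s = X n \<or> Re s = - X n"
  shows "admissible (exp s)"
proof (cases "Re s = X n")
  case True
  thus ?thesis by (intro admissible_circle[of _ n]) (simp add: norm_exp_eq_Re exp_X)
next
  case False
  hence "norm (exp s) = q ^ n * sqrt q"
    using assms by (simp add: norm_exp_eq_Re exp_minus exp_X)
  also have "\<dots> \<le> 1 * sqrt q"
    using q_power[of n] sqrt_q by (intro mult_right_mono) auto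
  finally show ?thesis by (intro admissible_small) simp
qed

lemma has_integral_log_integrand:
  assumes "x > 0"
  shows "((\<lambda>y. log_integrand z (of_real y)) has_integral (LBINT t:{exp (- x)..exp x}. integrand z t)) {- x..x}"
proof -
  have sub: "{exp (- x)..exp x} \<subseteq> {0<..}"
    using exp_gt_zero[of "- x"] by (auto simp del: exp_gt_zero)
  have "set_integrable lborel {exp (- x)..exp x} (integrand z)"
    by (rule set_integrable_subset[OF integrand_integrable]) (use sub in auto)
  hence eq: "(LBINT t:{exp (- x)..exp x}. integrand z t) = integral {exp (- x)..exp x} (integrand z)"
    by (rule set_borel_integral_eq_integral)
  have "((\<lambda>y. exp y *\<^sub>R integrand z (exp y)) has_integral (integral {exp (- x)..exp x} (integrand z))) {- x..x}"
  proof (rule has_integral_substitution)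
    show "continuous_on {exp (- x)..exp x} (integrand z)"
      by (rule continuous_on_subset[OF continuous_on_integrand sub])
    show "(exp has_field_derivative exp y) (at y within {- x..x})" for y :: real
      by (rule DERIV_subset[OF DERIV_exp]) simp
  qed (use assms in auto)
  moreover have "exp y *\<^sub>R integrand z (exp y) = log_integrand z (of_real y)" for y
    by (subst integrand_eq) (simp_all add: scaleR_conv_of_real)
  ultimately show ?thesis unfolding eq by simp
qed

lemma bottom_side:
  assumes "x > 0"
  shows "(log_integrand z has_contour_integral (LBINT t:{exp (- x)..exp x}. integrand z t)) (linepath (Complex (- x) 0) (Complex x 0))"
  using has_integral_log_integrand[OF assms, of z] assms
  by (subst has_contour_integral_linepath_Reals_iff) (auto simp: complex_is_Real_iff)

text \<open>
  The reason why the two values of \<open>w\<close> are integrals of one function over two parallel lines.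
\<close>
lemma log_integrand_shift: "log_integrand z (s + 2 * of_real pi * \<i>) = log_integrand (z - 2 * of_real pi * \<i>) s"
proof -
  have "exp (s + 2 * of_real pi * \<i>) = exp s"
    using exp_plus_2pin[of s 1] by (simp add: mult_ac)
  thus ?thesis by (simp add: log_integrand_def algebra_simps)
qed

lemma top_side:
  assumes "x > 0"
  shows "(log_integrand z has_contour_integral (LBINT t:{exp (- x)..exp x}. integrand (z - 2 * of_real pi * \<i>) t))
           (linepath (Complex (- x) (2 * pi)) (Complex x (2 * pi)))"
proof -
  have *: "linepath (Complex (- x) (2 * pi)) (Complex x (2 * pi))
        = (+) (2 * of_real pi * \<i>) \<circ> linepath (Complex (- x) 0) (Complex x 0)"
    by (auto simp: fun_eq_iff linepath_def complex_eq_iff algebra_simps)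
  show ?thesis
    unfolding * has_contour_integral_translate log_integrand_shift by (rule bottom_side) fact
qed

lemma integral_limit:
  "(\<lambda>n. LBINT t:{exp (- X n)..exp (X n)}. integrand z t) \<longlonglongrightarrow> (LBINT t:{0<..}. integrand z t)"
proof -
  have U: "(\<Union>n. {exp (- X n)..exp (X n)}) = {0<..}"
  proof (intro equalityI subsetI)
    fix t assume "t \<in> (\<Union>n. {exp (- X n)..exp (X n)})"
    then obtain n where "exp (- X n) \<le> t" by auto
    thus "t \<in> {0<..}" using exp_gt_zero[of "- X n"] by (simp del: exp_gt_zero)
  next
    fix t :: real assume "t \<in> {0<..}"
    hence t: "t > 0" by simp
    obtain n where "X n \<ge> \<bar>ln t\<bar>"
      using filterlim_X unfolding filterlim_at_top eventually_sequentially by blast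
    hence "exp (- X n) \<le> exp (ln t)" "exp (ln t) \<le> exp (X n)" by auto
    thus "t \<in> (\<Union>n. {exp (- X n)..exp (X n)})" using t by auto
  qed
  have "(\<lambda>n. LBINT t:{exp (- X n)..exp (X n)}. integrand z t) \<longlonglongrightarrow> (LBINT t:(\<Union>n. {exp (- X n)..exp (X n)}). integrand z t)"
  proof (rule set_integral_cont_up)
    show "incseq (\<lambda>n. {exp (- X n)..exp (X n)})"
      unfolding incseq_def by (auto intro: order_trans simp: X_mono)
    show "set_integrable lborel (\<Union>n. {exp (- X n)..exp (X n)}) (integrand z)"
      unfolding U by (rule integrand_integrable)
  qed auto
  thus ?thesis unfolding U .
qed

section \<open>The residue theorem on rectangles\<close>

text \<open>The logarithm of \<open>pole j\<close> with imaginary part \<open>\<pi>\<close>, the only one that the rectangles enclose.\<close>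
definition log_pole :: "nat \<Rightarrow> complex" where
  "log_pole j = of_real (real j * L) + of_real pi * \<i>"

lemma exp_log_pole: "exp (log_pole j) = pole j"
proof -
  have "exp (log_pole j) = of_real (exp (real j * L)) * exp (of_real pi * \<i>)"
    unfolding log_pole_def exp_add exp_of_real ..
  also have "exp (real j * L) = 1 / q ^ j"
    unfolding exp_of_nat_mult exp_L by (simp add: power_divide)
  finally show ?thesis by simp
qed

text \<open>
  A convex open neighbourhood of the \<open>n\<close>-th rectangle in which the integrand has no singularities
  apart from those inside the rectangle. The margin \<open>1\<close> in the imaginary direction stays below
  \<open>\<pi>\<close>, the distance to the neighbouring rows of poles.
\<close>
definition strip :: "nat \<Rightarrow> complex set" where
  "strip n = {s. Re s < (real n + 1) * L} \<inter> ({s. - 1 < Im s} \<inter> {s. Im s < 2 * pi + 1})"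

lemma open_strip: "open (strip n)"
  unfolding strip_def by (intro open_Int open_halfspace_Re_lt open_halfspace_Im_lt open_halfspace_Im_gt)

lemma convex_strip: "convex (strip n)"
  unfolding strip_def by (intro convex_Int convex_halfspace_Re_lt convex_halfspace_Im_lt convex_halfspace_Im_gt)

lemma exp_eq_pole_strip:
  assumes "s \<in> strip n" "exp s = pole j"
  shows "s = log_pole j" "j \<le> n"
proof -
  have "exp s = exp (log_pole j)" using assms exp_log_pole by simp
  then obtain k :: int where k: "s = log_pole j + of_real (2 * of_int k * pi) * \<i>"
    unfolding exp_eq by auto
  have im: "- 1 < pi + 2 * of_int k * pi" "pi + 2 * of_int k * pi < 2 * pi + 1"
    using assms(1) k by (auto simp: strip_def log_pole_def)
  have "k = 0"
  proof (rule ccontr)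
    assume "k \<noteq> 0"
    hence "k \<ge> 1 \<or> k \<le> -1" by linarith
    thus False
    proof
      assume "k \<ge> 1"
      hence "1 * pi \<le> real_of_int k * pi" by (intro mult_right_mono) auto
      thus False using im(2) pi_gt3 by linarith
    next
      assume "k \<le> -1"
      hence "real_of_int k \<le> -1" by linarith
      hence "real_of_int k * pi \<le> (-1) * pi" by (intro mult_right_mono) auto
      thus False using im(1) pi_gt3 by linarith
    qed
  qed
  thus s: "s = log_pole j" using k by simp
  have "real j * L < (real n + 1) * L" using assms(1) unfolding s by (simp add: strip_def log_pole_def)
  hence "real j < real n + 1" using L_pos by simp
  thus "j \<le> n" by linarith
qed

lemma inj_log_pole: "inj log_pole"
  using L_pos by (auto intro!: injI simp: log_pole_def complex_eq_iff)

lemma log_integrand_holomorphic: "log_integrand z holomorphic_on strip n - log_pole ` {..n}"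
proof -
  have "log_integrand z analytic_on {s}" if "s \<in> strip n - log_pole ` {..n}" for s
  proof (rule log_integrand_analytic, rule notI)
    assume "exp s \<in> range pole"
    then obtain j where "exp s = pole j" by blast
    from exp_eq_pole_strip[OF _ this, of n] that show False by auto
  qed
  hence "log_integrand z analytic_on (strip n - log_pole ` {..n})"
    using analytic_on_analytic_at by blast
  thus ?thesis by (rule analytic_imp_holomorphic)
qed

lemma log_pole_in_strip: "j \<le> n \<Longrightarrow> log_pole j \<in> strip n"
  using L_pos pi_gt3 by (simp add: strip_def log_pole_def)

text \<open>
  Passing from \<open>t\<close> to \<open>s\<close> divides the residue by the derivative \<open>exp (log_pole j) = - 1 / q ^ j\<close> of
  the exponential function. This cancels the power of \<open>q\<close> in \<open>pole_limit\<close> and produces the sign.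
\<close>
lemma residue_log_integrand: "residue (log_integrand z) (log_pole j) = - d j * Eq q (log_pole j - z)"
proof (rule residue_simple')
  let ?U = "strip j - log_pole ` {..<j}"
  show open_U: "open ?U"
    by (intro open_Diff open_strip finite_imp_closed) simp
  show in_U: "log_pole j \<in> ?U"
    using log_pole_in_strip[of j j] inj_log_pole by (auto dest: injD)
  have "?U - {log_pole j} = strip j - log_pole ` {..j}"
    by (auto simp: le_less)
  thus "log_integrand z holomorphic_on (?U - {log_pole j})"
    using log_integrand_holomorphic[of z j] by (simp only:)
  have "eventually (\<lambda>s. s \<in> ?U - {log_pole j}) (at (log_pole j))"
    using eventually_at_in_open[OF open_U in_U] .
  hence ne: "eventually (\<lambda>s. exp s \<noteq> pole j) (at (log_pole j))"
    by eventually_elim (use exp_eq_pole_strip(1)[of _ j j] in blast)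
  have "(exp \<longlongrightarrow> exp (log_pole j)) (at (log_pole j))"
    by (intro tendsto_exp tendsto_ident_at)
  hence lim: "(exp \<longlongrightarrow> pole j) (at (log_pole j))"
    unfolding exp_log_pole .
  have "(((\<lambda>t. (t - pole j) * B t) \<circ> exp) \<longlongrightarrow> d j / of_real q ^ j) (at (log_pole j))"
    by (rule tendsto_compose_at[OF lim pole_limit]) (use ne in eventually_elim, simp)
  hence l1: "((\<lambda>s. (exp s - pole j) * B (exp s)) \<longlongrightarrow> d j / of_real q ^ j) (at (log_pole j))"
    unfolding o_def .
  have "(exp has_field_derivative pole j) (at (log_pole j))"
    using DERIV_exp[of "log_pole j"] unfolding exp_log_pole .
  hence l2: "((\<lambda>s. (exp s - pole j) / (s - log_pole j)) \<longlongrightarrow> pole j) (at (log_pole j))"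
    unfolding has_field_derivative_iff exp_log_pole .
  have "isCont (\<lambda>s. Eq q (s - z)) (log_pole j)"
    unfolding Eq_def ln_q using L_pos by (intro continuous_intros) auto
  hence l3: "((\<lambda>s. Eq q (s - z)) \<longlongrightarrow> Eq q (log_pole j - z)) (at (log_pole j))"
    by (simp only: isCont_def)
  have "((\<lambda>s. ((exp s - pole j) * B (exp s)) / ((exp s - pole j) / (s - log_pole j)) * Eq q (s - z))
          \<longlongrightarrow> (d j / of_real q ^ j) / pole j * Eq q (log_pole j - z)) (at (log_pole j))"
    using of_real_q_nonzero by (intro tendsto_mult tendsto_divide l1 l2 l3) simp
  moreover have "eventually (\<lambda>s. ((exp s - pole j) * B (exp s)) / ((exp s - pole j) / (s - log_pole j)) * Eq q (s - z)
        = log_integrand z s * (s - log_pole j)) (at (log_pole j))"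
    using ne eventually_neq_at_within[of "log_pole j"]
  proof eventually_elim
    case (elim s)
    hence "exp s - pole j \<noteq> 0" "s - log_pole j \<noteq> 0" by (simp_all only: right_minus_eq not_False_eq_True)
    thus ?case by (simp add: log_integrand_def del: right_minus_eq)
  qed
  moreover have "(d j / of_real q ^ j) / pole j * Eq q (log_pole j - z) = - d j * Eq q (log_pole j - z)"
    using of_real_q_nonzero by (simp del: d_coeff.simps)
  ultimately show "((\<lambda>s. log_integrand z s * (s - log_pole j)) \<longlongrightarrow> - d j * Eq q (log_pole j - z)) (at (log_pole j))"
    using Lim_transform_eventually by (simp only:)
qed

text \<open>
  With \<open>u = \<pi> \<i> - z\<close> and \<open>l = ln q\<close>, expanding the square \<open>(u - j l - l / 2)\<^sup>2 / (2 l)\<close> leaves, besides the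
  term \<open>(u - l / 2)\<^sup>2 / (2 l)\<close> of \<open>Eq q u\<close>, the terms \<open>- j u\<close> and \<open>l j (j + 1) / 2\<close>.
\<close>
lemma Eq_log_pole:
  "Eq q (log_pole j - z) = Eq q (of_real pi * \<i> - z) * (of_real q ^ (j * (j + 1) div 2) * (- 1) ^ j * exp z ^ j)"
proof -
  define u where "u = of_real pi * \<i> - z"
  define l where "l = complex_of_real (ln q)"
  have l0: "l \<noteq> 0" using q by (simp add: l_def)
  have sq: "complex_of_real (ln (sqrt q)) = l / 2"
    using q by (simp add: ln_sqrt l_def)
  define N where "N = j * (j + 1) div 2"
  have "2 * N = j * (j + 1)" unfolding N_def by simp
  hence "of_nat (2 * N) = (of_nat (j * (j + 1)) :: complex)" by (rule arg_cong)
  hence N: "of_nat j * l / 2 + of_nat j ^ 2 * l / 2 = of_nat N * l"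
    by (simp add: field_simps power2_eq_square)
  have s: "log_pole j - z = u - of_nat j * l"
    by (simp add: log_pole_def u_def l_def L_def)
  have "(log_pole j - z - l / 2) ^ 2 / (2 * l) = (u - l / 2) ^ 2 / (2 * l) - of_nat j * u + (of_nat j * l / 2 + of_nat j ^ 2 * l / 2)"
    unfolding s using l0 by (simp add: field_simps power2_eq_square)
  also have "\<dots> = (u - l / 2) ^ 2 / (2 * l) + (of_nat N * l + of_nat j * (- u))"
    unfolding N by simp
  finally have "Eq q (log_pole j - z) = Eq q u * (exp l ^ N * exp (- u) ^ j)"
    unfolding Eq_def sq l_def[symmetric] exp_add exp_of_nat_mult[symmetric] by (simp only: exp_add)
  moreover have "exp l = of_real q"
    unfolding l_def exp_of_real using q by simp
  moreover have "exp (- u) = - exp z"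
    unfolding u_def by (simp add: exp_diff)
  ultimately show ?thesis
    unfolding u_def N_def by (simp add: power_minus[of "exp z"] mult_ac)
qed

definition W :: "complex \<Rightarrow> complex" where
  "W z = (LBINT t:{0<..}. integrand z t)"

definition J :: "complex \<Rightarrow> nat \<Rightarrow> complex" where
  "J z n = (LBINT t:{exp (- X n)..exp (X n)}. integrand z t)"

lemma rectangle:
  assumes "M \<ge> 0" and M: "\<And>s. \<bar>Im s\<bar> \<le> 2 * pi \<Longrightarrow> admissible (exp s) \<Longrightarrow> norm (log_integrand z s) * (exp (Re s) + exp (- Re s)) \<le> M"
  shows "norm (J z n - J (z - 2 * of_real pi * \<i>) n - 2 * of_real pi * \<i> * (\<Sum>j\<le>n. residue (log_integrand z) (log_pole j)))
           \<le> 4 * pi * M * exp (- X n)"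
proof -
  define a1 where "a1 = Complex (- X n) 0"
  define a2 where "a2 = Complex (X n) 0"
  define a3 where "a3 = Complex (X n) (2 * pi)"
  define a4 where "a4 = Complex (- X n) (2 * pi)"
  have vert: "norm (log_integrand z s) \<le> M * exp (- X n)" and vert_cont: "isCont (log_integrand z) s"
    if "Re s = X n \<or> Re s = - X n" "0 \<le> Im s" "Im s \<le> 2 * pi" for s
  proof -
    have "admissible (exp s)" by (rule admissible_vertical) fact
    thus "isCont (log_integrand z) s" by (intro isCont_log_integrand admissible_not_pole)
    have "norm (log_integrand z s) * exp (X n) \<le> norm (log_integrand z s) * (exp (Re s) + exp (- Re s))"
      using that(1) by (intro mult_left_mono) auto
    also have "\<dots> \<le> M"
      using that \<open>admissible (exp s)\<close> by (intro M) auto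
    finally show "norm (log_integrand z s) \<le> M * exp (- X n)"
      by (simp add: exp_minus field_simps)
  qed
  have seg: "Re s = Re u \<and> 0 \<le> Im s \<and> Im s \<le> 2 * pi"
    if "s \<in> closed_segment u v" "Re u = Re v" "Im u \<in> {0..2*pi}" "Im v \<in> {0..2*pi}" for s u v
  proof -
    have "closed_segment u v \<subseteq> ({w. Re w \<ge> Re u} \<inter> {w. Re w \<le> Re u}) \<inter> ({w. Im w \<ge> 0} \<inter> {w. Im w \<le> 2 * pi})"
      using that by (intro closed_segment_subset convex_Int convex_halfspace_Re_ge convex_halfspace_Re_le
                       convex_halfspace_Im_ge convex_halfspace_Im_le) auto
    hence "s \<in> ({w. Re w \<ge> Re u} \<inter> {w. Re w \<le> Re u}) \<inter> ({w. Im w \<ge> 0} \<inter> {w. Im w \<le> 2 * pi})"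
      using that(1) by (rule subsetD)
    thus ?thesis by simp
  qed
  have side: "log_integrand z contour_integrable_on linepath u v \<and> norm (contour_integral (linepath u v) (log_integrand z)) \<le> M * exp (- X n) * (2 * pi)"
    if "(u, v) = (a2, a3) \<or> (u, v) = (a4, a1)" for u v
  proof
    have pts: "(Re s = X n \<or> Re s = - X n) \<and> 0 \<le> Im s \<and> Im s \<le> 2 * pi" if "s \<in> closed_segment u v" for s
      using seg[OF that] \<open>_ \<or> _\<close> by (auto simp: a1_def a2_def a3_def a4_def)
    show c: "log_integrand z contour_integrable_on linepath u v"
      by (intro contour_integrable_continuous_linepath continuous_at_imp_continuous_on ballI vert_cont) (use pts in blast)+
    have "norm (contour_integral (linepath u v) (log_integrand z)) \<le> M * exp (- X n) * norm (v - u)"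
      by (rule contour_integral_bound_linepath[OF c]) (use pts vert \<open>M \<ge> 0\<close> in auto)
    also have "norm (v - u) = 2 * pi"
      using that by (auto simp: a1_def a2_def a3_def a4_def cmod_def real_sqrt_mult)
    finally show "norm (contour_integral (linepath u v) (log_integrand z)) \<le> M * exp (- X n) * (2 * pi)" .
  qed
  have bot: "(log_integrand z has_contour_integral J z n) (linepath a1 a2)"
    unfolding a1_def a2_def J_def by (rule bottom_side[OF X_pos])
  have "(log_integrand z has_contour_integral J (z - 2 * of_real pi * \<i>) n) (linepath a4 a3)"
    unfolding a3_def a4_def J_def by (rule top_side[OF X_pos])
  from has_contour_integral_reversepath[OF _ this]
  have top: "(log_integrand z has_contour_integral (- J (z - 2 * of_real pi * \<i>) n)) (linepath a3 a4)"
    by simp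
  have r: "(log_integrand z has_contour_integral contour_integral (linepath a2 a3) (log_integrand z)) (linepath a2 a3)"
    and l: "(log_integrand z has_contour_integral contour_integral (linepath a4 a1) (log_integrand z)) (linepath a4 a1)"
    using side[of a2 a3] side[of a4 a1] by (simp_all add: has_contour_integral_integral)
  have "rectpath a1 a3 = linepath a1 a2 +++ linepath a2 a3 +++ linepath a3 a4 +++ linepath a4 a1"
    by (simp add: rectpath_def Let_def a1_def a2_def a3_def a4_def)
  hence 1: "contour_integral (rectpath a1 a3) (log_integrand z)
      = J z n + (contour_integral (linepath a2 a3) (log_integrand z) + (- J (z - 2 * of_real pi * \<i>) n + contour_integral (linepath a4 a1) (log_integrand z)))"
    by (simp only:) (intro contour_integral_unique has_contour_integral_join bot r top l valid_path_join valid_path_linepath; simp)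
  have cbox: "cbox a1 a3 \<subseteq> strip n"
    using L_pos pi_gt_zero by (auto simp: in_cbox_complex_iff a1_def a3_def strip_def X_def algebra_simps)
  have in_box: "log_pole j \<in> box a1 a3" if "j \<le> n" for j
  proof -
    have "real j * L \<le> real n * L" using that L_pos by (intro mult_right_mono) auto
    moreover have "0 \<le> real j * L" "0 \<le> real n * L" using L_pos by auto
    ultimately have "- X n < real j * L" "real j * L < X n"
      using L_pos unfolding X_def distrib_right by linarith+
    thus ?thesis
      by (simp add: in_box_complex_iff a1_def a3_def log_pole_def)
  qed
  have le: "Re a1 \<le> Re a3" "Im a1 \<le> Im a3" using X_pos[of n] by (auto simp: a1_def a3_def)
  have "contour_integral (rectpath a1 a3) (log_integrand z)
      = 2 * pi * \<i> * (\<Sum>p\<in>log_pole ` {..n}. winding_number (rectpath a1 a3) p * residue (log_integrand z) p)"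
  proof (rule Residue_theorem[OF open_strip convex_connected[OF convex_strip] _ log_integrand_holomorphic])
    show "path_image (rectpath a1 a3) \<subseteq> strip n - log_pole ` {..n}"
      unfolding path_image_rectpath_cbox_minus_box[OF le] using cbox in_box by auto
    show "\<forall>p. p \<notin> strip n \<longrightarrow> winding_number (rectpath a1 a3) p = 0"
      using cbox by (auto intro!: winding_number_rectpath_outside le)
  qed auto
  also have "(\<Sum>p\<in>log_pole ` {..n}. winding_number (rectpath a1 a3) p * residue (log_integrand z) p)
      = (\<Sum>j\<le>n. winding_number (rectpath a1 a3) (log_pole j) * residue (log_integrand z) (log_pole j))"
    by (rule sum.reindex_cong[OF inj_on_subset[OF inj_log_pole]]) auto
  also have "\<dots> = (\<Sum>j\<le>n. residue (log_integrand z) (log_pole j))"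
    by (intro sum.cong refl) (simp add: winding_number_rectpath in_box)
  finally have 2: "contour_integral (rectpath a1 a3) (log_integrand z) = 2 * of_real pi * \<i> * (\<Sum>j\<le>n. residue (log_integrand z) (log_pole j))"
    by simp
  define I2 where "I2 = contour_integral (linepath a2 a3) (log_integrand z)"
  define I4 where "I4 = contour_integral (linepath a4 a1) (log_integrand z)"
  have I: "norm I2 \<le> M * exp (- X n) * (2 * pi)" "norm I4 \<le> M * exp (- X n) * (2 * pi)"
    using side[of a2 a3] side[of a4 a1] unfolding I2_def I4_def by blast+
  have "J z n - J (z - 2 * of_real pi * \<i>) n - 2 * of_real pi * \<i> * (\<Sum>j\<le>n. residue (log_integrand z) (log_pole j))
      = - (I2 + I4)"
    unfolding 2[symmetric] 1 I2_def I4_def by simp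
  hence "norm (J z n - J (z - 2 * of_real pi * \<i>) n - 2 * of_real pi * \<i> * (\<Sum>j\<le>n. residue (log_integrand z) (log_pole j)))
      = norm (I2 + I4)"
    by (simp only: norm_minus_cancel)
  also have "\<dots> \<le> norm I2 + norm I4"
    by (rule norm_triangle_ineq)
  also have "\<dots> \<le> 4 * pi * M * exp (- X n)"
    using add_mono[OF I] by (simp add: mult_ac)
  finally show ?thesis .
qed

text \<open>
  The connection formula as an identity. Convergence of the series need not be shown separately: its
  partial sums are the residue sums of the rectangles, and these converge with the integrals.
\<close>
lemma stokes_sums:
  "(\<lambda>n. d n * of_real q ^ (n * (n + 1) div 2) * (- 1) ^ n * exp z ^ n) sums
     ((W (z - 2 * of_real pi * \<i>) - W z) / (2 * of_real pi * \<i> * Eq q (of_real pi * \<i> - z)))"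
proof -
  let ?R = "\<lambda>n. \<Sum>j\<le>n. residue (log_integrand z) (log_pole j)"
  let ?E = "Eq q (of_real pi * \<i> - z)"
  let ?c = "\<lambda>j. d j * of_real q ^ (j * (j + 1) div 2) * (- 1) ^ j * exp z ^ j"
  obtain M where M: "M \<ge> 0" "\<And>s. \<bar>Im s\<bar> \<le> 2 * pi \<Longrightarrow> admissible (exp s) \<Longrightarrow> norm (log_integrand z s) * (exp (Re s) + exp (- Re s)) \<le> M"
    using log_integrand_decay by blast
  have "(\<lambda>n. exp (- X n)) \<longlonglongrightarrow> 0"
    by (rule filterlim_compose[OF exp_at_bot]) (use filterlim_X in \<open>simp add: filterlim_uminus_at_top\<close>)
  from tendsto_mult[OF tendsto_const this]
  have "(\<lambda>n. 4 * pi * M * exp (- X n)) \<longlonglongrightarrow> 0" by simp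
  hence l1: "(\<lambda>n. J z n - J (z - 2 * of_real pi * \<i>) n - 2 * of_real pi * \<i> * ?R n) \<longlonglongrightarrow> 0"
    by (rule Lim_null_comparison[rotated]) (simp add: rectangle[OF M])
  have l2: "(\<lambda>n. J z n - J (z - 2 * of_real pi * \<i>) n) \<longlonglongrightarrow> W z - W (z - 2 * of_real pi * \<i>)"
    unfolding J_def W_def by (intro tendsto_diff integral_limit)
  have "(\<lambda>n. (J z n - J (z - 2 * of_real pi * \<i>) n)
        - (J z n - J (z - 2 * of_real pi * \<i>) n - 2 * of_real pi * \<i> * ?R n))
        \<longlonglongrightarrow> (W z - W (z - 2 * of_real pi * \<i>)) - 0"
    by (rule tendsto_diff[OF l2 l1])
  hence "(\<lambda>n. 2 * of_real pi * \<i> * ?R n) \<longlonglongrightarrow> W z - W (z - 2 * of_real pi * \<i>)"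
    by simp
  moreover have "?R n = - ?E * (\<Sum>j\<le>n. ?c j)" for n
    unfolding sum_distrib_left by (intro sum.cong refl) (simp add: residue_log_integrand Eq_log_pole mult_ac del: d_coeff.simps)
  ultimately have "(\<lambda>n. - (2 * of_real pi * \<i> * ?E) * (\<Sum>j\<le>n. ?c j)) \<longlonglongrightarrow> W z - W (z - 2 * of_real pi * \<i>)"
    by (simp add: mult_ac)
  from tendsto_divide[OF this tendsto_const, of "- (2 * of_real pi * \<i> * ?E)"]
  have "(\<lambda>n. \<Sum>j\<le>n. ?c j) \<longlonglongrightarrow> (W z - W (z - 2 * of_real pi * \<i>)) / (- (2 * of_real pi * \<i> * ?E))"
    by (simp add: Eq_def)
  also have "(W z - W (z - 2 * of_real pi * \<i>)) / (- (2 * of_real pi * \<i> * ?E))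
      = (W (z - 2 * of_real pi * \<i>) - W z) / (2 * of_real pi * \<i> * ?E)"
    by (simp add: divide_simps Eq_def)
  finally show ?thesis by (simp add: sums_def_le)
qed

end

section \<open>The asymptotic expansion\<close>

text \<open>
  Every nonzero number is a value of \<open>exp\<close>, so convergence for all \<open>z\<close> makes the power series entire
  in \<open>exp z\<close>; its remainder after \<open>N\<close> terms is \<open>exp z ^ Suc N\<close> times a function continuous at \<open>0\<close>.
\<close>
lemma poincare_expansion_powser:
  assumes "\<And>z. (\<lambda>n. c n * exp z ^ n) sums F z"
  shows "poincare_expansion F c \<theta>"
  unfolding poincare_expansion_def
proof
  fix N
  define G where "G w = (\<Sum>n. c (n + Suc N) * w ^ n)" for w
  have summ: "summable (\<lambda>n. c n * w ^ n)" for w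
  proof (cases "w = 0")
    case False
    hence "exp (ln w) = w" by (rule exp_Ln)
    with sums_summable[OF assms[of "ln w"]] show ?thesis by (simp only:)
  qed (simp only: sums_summable[OF powser_sums_zero])
  have summ': "summable (\<lambda>n. c (n + Suc N) * w ^ n)" for w
  proof (cases "w = 0")
    case False
    have "summable (\<lambda>n. c (n + Suc N) * w ^ (n + Suc N))"
      by (rule summable_ignore_initial_segment[OF summ])
    hence "summable (\<lambda>n. c (n + Suc N) * w ^ (n + Suc N) / w ^ Suc N)"
      by (rule summable_divide)
    thus ?thesis using False by (simp add: power_add)
  qed (simp only: sums_summable[OF powser_sums_zero])
  have G0: "(G \<longlongrightarrow> c (0 + Suc N)) (at 0)"
    unfolding G_def by (rule powser_limit_0[OF zero_less_one]) (rule summable_sums[OF summ'])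
  have eq: "F z - (\<Sum>n\<le>N. c n * exp z ^ n) = exp z ^ N * (exp z * G (exp z))" for z
  proof -
    have "F z = (\<Sum>n. c n * exp z ^ n)" using assms[of z] by (rule sums_unique)
    also have "\<dots> = (\<Sum>n. c (n + Suc N) * exp z ^ (n + Suc N)) + (\<Sum>n<Suc N. c n * exp z ^ n)"
      by (rule suminf_split_initial_segment[OF summ])
    also have "(\<Sum>n. c (n + Suc N) * exp z ^ (n + Suc N)) = (\<Sum>n. exp z ^ Suc N * (c (n + Suc N) * exp z ^ n))"
      by (simp add: power_add mult_ac)
    also have "\<dots> = exp z ^ Suc N * G (exp z)"
      unfolding G_def by (rule suminf_mult[OF summ'])
    finally show ?thesis by (simp add: lessThan_Suc_atMost mult_ac)
  qed
  have small: "((\<lambda>r. exp (surface_pt r \<theta>)) \<longlongrightarrow> 0) (at_right 0)"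
  proof (rule tendsto_norm_zero_cancel)
    have "((\<lambda>r::real. r) \<longlongrightarrow> 0) (at_right 0)"
      by (rule tendsto_ident_at)
    moreover have "eventually (\<lambda>r. r = norm (exp (surface_pt r \<theta>))) (at_right 0)"
      using eventually_at_right_less[of 0]
      by eventually_elim (simp add: surface_pt_def norm_exp_eq_Re)
    ultimately show "((\<lambda>r. norm (exp (surface_pt r \<theta>))) \<longlongrightarrow> 0) (at_right 0)"
      by (rule Lim_transform_eventually)
  qed
  have "((\<lambda>r. G (exp (surface_pt r \<theta>))) \<longlongrightarrow> c (0 + Suc N)) (at_right 0)"
    by (rule tendsto_compose_at[OF small G0, unfolded o_def]) simp
  from tendsto_mult[OF small this]
  have lim: "((\<lambda>r. exp (surface_pt r \<theta>) * G (exp (surface_pt r \<theta>))) \<longlongrightarrow> 0) (at_right 0)"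
    by simp
  show "(\<lambda>r. F (surface_pt r \<theta>) - (\<Sum>n\<le>N. c n * exp (surface_pt r \<theta>) ^ n))
          \<in> o[at_right 0](\<lambda>r. exp (surface_pt r \<theta>) ^ N)"
    unfolding eq by (rule smalloI_tendsto) (use lim in simp_all)
qed

theorem mainTheorem2:
  fixes q :: real and a b :: complex and \<theta> :: real
  assumes "0 < q" and "q < 1"
  shows "poincare_expansion
           (\<lambda>z. (qBL q a b (z - 2 * of_real pi * \<i>) - qBL q a b z)
                 / (2 * of_real pi * \<i> * of_real (Cq q) * Eq q (of_real pi * \<i> - z)))
           (\<lambda>n. d_coeff q a b n * of_real q ^ (n * (n + 1) div 2) * (- 1) ^ n)
           \<theta>"
proof (rule poincare_expansion_powser)
  interpret q_params q a b by standard (fact assms)+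
  fix z
  have "ln q < 0" using assms by simp
  hence C: "Cq q \<noteq> 0" by (simp add: Cq_def)
  have qBL: "qBL q a b z = of_real (Cq q) * W z" for z
    by (simp add: qBL_def W_def)
  have "(qBL q a b (z - 2 * of_real pi * \<i>) - qBL q a b z)
           / (2 * of_real pi * \<i> * of_real (Cq q) * Eq q (of_real pi * \<i> - z))
      = (W (z - 2 * of_real pi * \<i>) - W z) / (2 * of_real pi * \<i> * Eq q (of_real pi * \<i> - z))"
    unfolding qBL right_diff_distrib[symmetric] using C by simp
  thus "(\<lambda>n. d_coeff q a b n * of_real q ^ (n * (n + 1) div 2) * (- 1) ^ n * exp z ^ n) sums
          ((qBL q a b (z - 2 * of_real pi * \<i>) - qBL q a b z)
             / (2 * of_real pi * \<i> * of_real (Cq q) * Eq q (of_real pi * \<i> - z)))"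
    using stokes_sums[of z] by simp
qed

end
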